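(* Consider the equation $$x'(t)=\sum_{k=1}^{M}\lambda_k r_k(t)\frac{x^{m_k}(t-\tau_k(t))}{1+x^{n_k}(t-\mu_k(t))}-b(t)x(t)\qquad( * )$$ and assume that $m_j>n_j+1$ for some $j\in\{1,\dots,M\}$. \begin{enumerate} \item Let $m_k>1$ for all $k$ and $1<m_i<n_i+1$ for some $i$. Assume there exist constants $\gamma_1<\gamma_2$ such that $\alpha(\gamma_1,t)>0>\beta(\gamma_2,t)$ for all $t$. Then $( * )$ admits at least $3$ positive $T$-periodic solutions. \item Let $m_k\ge 1$ for all $k$, $m_i=1$ for some $i$, and $m_k\notin(1,n_k+1)$ for all $k$. Assume that $\sum_{k\in M_2}\lambda_k r_k(t)>b(t)$ for all $t$ and that there exists $\gamma_1$ such that $\beta(\gamma_1,t)<0$ for all $t$. Then $( * )$ admits at least $2$ positive $T$-periodic solutions. \item Let $m_k\ge 1$ for all $k$, $m_i=1$ for some $i$ and $1<m_s<n_s+1$ for some $s$. Assume that $\sum_{k\in M_2}\lambda_k r_k(t)e^{C}<b(t)$ for all $t$ and that there exist constants $\gamma_1<\gamma_2$ such that $\alpha(\gamma_1,t)>0>\beta(\gamma_2,t)$ for all $t$. Then $( * )$ admits at least $3$ positive $T$-periodic solutions. \item Let $m_i<1$ for some $i$ and $m_k\notin(1,n_k+1)$ for all $k$. Assume there is a constant $\gamma_1$ such that $\beta(\gamma_1,t)<0$ for all $t$. Then $( * )$ admits at least $2$ positive $T$-periodic solutions. \item Let $m_i<1$ for some $i$ and $1<m_s<n_s+1$ for some $s$.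 Assume there exist constants $\gamma_1<\gamma_2<\gamma_3$ such that $\alpha(\gamma_2,t)>0$, $\beta(\gamma_1,t)<0$ and $\beta(\gamma_3,t)<0$ for all $t$. Then $( * )$ admits at least $4$ positive $T$-periodic solutions. \end{enumerate}
   Context: Let $T>0$ and let $M\ge 1$ be an integer. For $k=1,\dots,M$, let $\lambda_k,m_k,n_k$ be positive real constants, and let $r_k,\tau_k,\mu_k$ and $b$ be continuous, positive, $T$-periodic functions $\mathbb{R}\to\mathbb{R}$. Set $C:=\int_0^T b(t)\,dt$ and $M_2:=\{k: m_k=1\}$. For $\gamma,t\in\mathbb{R}$ define $$\alpha(\gamma,t):=\sum_{k=1}^{M}\lambda_k r_k(t)\frac{e^{(m_k-1)\gamma}e^{-Cm_k}}{1+e^{n_k(\gamma+C)}}-b(t),\qquad \beta(\gamma,t):=\sum_{k=1}^{M}\lambda_k r_k(t)\frac{e^{(m_k-1)\gamma}e^{Cm_k}}{1+e^{n_k(\gamma-C)}}-b(t).$$ The constants $\gamma_i$ are real. Here $x^{m}(s)$ means $(x(s))^{m}$. A positive $T$-periodic solution is a $T$-periodic differentiable function $x:\mathbb{R}\to(0,\infty)$ satisfying the equation for all $t\in\mathbb{R}$; solutions are counted as distinct functions. *)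

theory Defs
  imports "HOL-Analysis.Analysis" "HOL-Library.Periodic_Fun"
begin

definition C_const :: "real \<Rightarrow> (real \<Rightarrow> real) \<Rightarrow> real" where
  "C_const T b = integral {0..T} b"

definition M2 :: "nat \<Rightarrow> (nat \<Rightarrow> real) \<Rightarrow> nat set" where
  "M2 M m = {k \<in> {1..M}. m k = 1}"

definition alpha ::
  "real \<Rightarrow> nat \<Rightarrow> (nat \<Rightarrow> real) \<Rightarrow> (nat \<Rightarrow> real) \<Rightarrow> (nat \<Rightarrow> real) \<Rightarrow>
   (nat \<Rightarrow> real \<Rightarrow> real) \<Rightarrow> (real \<Rightarrow> real) \<Rightarrow> real \<Rightarrow> real \<Rightarrow> real" where
  "alpha T M lam m n r b \<gamma> t =
     (\<Sum>k=1..M. lam k * r k t *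
        (exp ((m k - 1) * \<gamma>) * exp (- C_const T b * m k)) /
        (1 + exp (n k * (\<gamma> + C_const T b)))) - b t"

definition beta ::
  "real \<Rightarrow> nat \<Rightarrow> (nat \<Rightarrow> real) \<Rightarrow> (nat \<Rightarrow> real) \<Rightarrow> (nat \<Rightarrow> real) \<Rightarrow>
   (nat \<Rightarrow> real \<Rightarrow> real) \<Rightarrow> (real \<Rightarrow> real) \<Rightarrow> real \<Rightarrow> real \<Rightarrow> real" where
  "beta T M lam m n r b \<gamma> t =
     (\<Sum>k=1..M. lam k * r k t *
        (exp ((m k - 1) * \<gamma>) * exp (C_const T b * m k)) /
        (1 + exp (n k * (\<gamma> - C_const T b)))) - b t"

text \<open>\<^const>\<open>powr\<close> is the usual real power here, since only positive \<open>x\<close> are considered.\<close>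
definition positive_periodic_solutions ::
  "real \<Rightarrow> nat \<Rightarrow> (nat \<Rightarrow> real) \<Rightarrow> (nat \<Rightarrow> real) \<Rightarrow> (nat \<Rightarrow> real) \<Rightarrow>
   (nat \<Rightarrow> real \<Rightarrow> real) \<Rightarrow> (nat \<Rightarrow> real \<Rightarrow> real) \<Rightarrow> (nat \<Rightarrow> real \<Rightarrow> real) \<Rightarrow>
   (real \<Rightarrow> real) \<Rightarrow> (real \<Rightarrow> real) set" where
  "positive_periodic_solutions T M lam m n r \<tau> \<mu> b =
     {x. periodic_fun_simple x T \<and> (\<forall>t. x t > 0) \<and>
         (\<forall>t. (x has_real_derivative
            ((\<Sum>k=1..M. lam k * r k t * (x (t - \<tau> k t) powr m k) /
                (1 + x (t - \<mu> k t) powr n k)) - b t * x t)) (at t))}"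

text \<open>\<^const>\<open>card\<close> is \<open>0\<close> on infinite sets, so an inequality on \<open>card A\<close> would exclude infinite \<open>A\<close>.\<close>
definition has_at_least :: "nat \<Rightarrow> 'a set \<Rightarrow> bool" where
  "has_at_least N A \<longleftrightarrow> (\<exists>S \<subseteq> A. finite S \<and> card S = N)"

end

theory Submission
  imports Defs "HOL-Complex_Analysis.Great_Picard" "HOL-Real_Asymp.Real_Asymp"
begin

text \<open>
  Write \<open>x = exp u\<close>. Freezing the delayed terms at \<open>u\<close>, the linear equation
  \<open>y' = g(u) - b y\<close> has a unique periodic solution \<open>y > 0\<close>; solutions of the problem are
  the fixed points of \<open>V u = ln y\<close>. As \<open>(V u)' \<ge> - b\<close>, the oscillation of \<open>V u\<close> is at most
  \<open>C\<close>, so only functions \<open>u\<close> with values in \<open>[p, p + C]\<close>, \<open>p = min u\<close>, matter. For such \<open>u\<close>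
  the conditions on \<open>\<alpha>\<close> and \<open>\<beta>\<close> at \<open>p\<close> force \<open>V u > p\<close> and \<open>V u < p\<close>, respectively, by
  comparison with the constant \<open>exp p\<close>. Between two levels with opposite signs, Schauder's theorem
  yields a fixed point: if \<open>V\<close> pushes the minimum into the interval, directly; if \<open>V\<close> pushes it
  out, after reflecting the displacement of the minimum, which does not change the fixed points.
  The hypotheses of each case, together with the behaviour of \<open>\<alpha>\<close> and \<open>\<beta>\<close> at \<open>-\<infinity>\<close> and
  \<open>+\<infinity>\<close>, give 2, 3 or 4 consecutive intervals with such a sign change, and solutions belonging
  to different intervals have different minima.
\<close>

section \<open>Brouwer's theorem on cubes of arbitrary dimension\<close>

lemma compact_PiE_UNIV:
  fixes X :: "'i \<Rightarrow> 'a::topological_space set"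
  assumes "\<And>i. compact (X i)"
  shows "compact (PiE UNIV X)"
  using compactin_PiE[of "\<lambda>_. euclidean" UNIV X] assms by (simp add: euclidean_product_topology)

lemma tendsto_fun_component:
  fixes X :: "'c \<Rightarrow> 'a \<Rightarrow> 'b::topological_space"
  assumes "(X \<longlongrightarrow> y) F"
  shows "((\<lambda>n. X n i) \<longlongrightarrow> y i) F"
  using continuous_on_tendsto_compose[OF continuous_on_product_coordinates[of i] assms] by simp

lemma tendsto_funI:
  fixes X :: "'c \<Rightarrow> 'a \<Rightarrow> 'b::topological_space"
  assumes "\<And>i. ((\<lambda>n. X n i) \<longlongrightarrow> y i) F"
  shows "(X \<longlongrightarrow> y) F"
  using assms limitin_componentwise[of "\<lambda>_. euclidean" UNIV X y F]
  by (simp add: euclidean_product_topology)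

text \<open>Kuhn's combinatorial lemma yields grid cells of mesh tending to 0 in which each of the
  first \<open>n\<close> coordinates of \<open>g x - x\<close> is nonnegative at one point and
  nonpositive at another; a limit of such cells is the point sought. Points are functions on
  \<open>nat\<close>, so the dimension \<open>n\<close> is a variable rather than a type.\<close>

lemma brouwer_cube_nat:
  fixes g :: "(nat \<Rightarrow> real) \<Rightarrow> nat \<Rightarrow> real" and n :: nat
  defines "K \<equiv> PiE UNIV (\<lambda>_. {0..1})"
  assumes cont: "continuous_on K g"
    and g01: "\<And>x i. x \<in> K \<Longrightarrow> i < n \<Longrightarrow> g x i \<in> {0..1}"
  shows "\<exists>x\<in>K. \<forall>i<n. g x i = x i"
proof -
  define near where "near N x w \<longleftrightarrow> w \<in> K \<and> (\<forall>j. \<bar>w j - x j\<bar> \<le> inverse (real (Suc N)))"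
    for N and x w :: "nat \<Rightarrow> real"
  have cell: "\<exists>x\<in>K. \<forall>i<n. (\<exists>r. near N x r \<and> r i \<le> g r i) \<and> (\<exists>s. near N x s \<and> g s i \<le> s i)" for N
  proof -
    define p where "p = Suc N"
    define pt :: "(nat \<Rightarrow> nat) \<Rightarrow> nat \<Rightarrow> real" where "pt q = (\<lambda>i. if i < n then q i / p else 0)" for q
    \<comment> \<open>Label 0 means that \<open>g\<close> does not decrease coordinate
      \<open>i\<close>. On the faces \<open>q i = 0\<close> and \<open>q i = p\<close> Kuhn's lemma
      prescribes the labels 0 and 1, which are truthful there since the coordinates of
      \<open>g\<close> below \<open>n\<close> lie in \<open>{0..1}\<close>.\<close>
    define label :: "(nat \<Rightarrow> nat) \<Rightarrow> nat \<Rightarrow> nat" where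
      "label q i = (if q i = 0 \<or> (q i \<noteq> p \<and> pt q i \<le> g (pt q) i) then 0 else 1)" for q i
    have ptK: "pt q \<in> K" if "\<forall>i<n. q i \<le> p" for q
      using that by (auto simp: pt_def K_def p_def)
    obtain q where q: "\<forall>i<n. q i < p"
      and rs: "\<forall>i<n. \<exists>r s. (\<forall>j<n. q j \<le> r j \<and> r j \<le> q j + 1) \<and>
        (\<forall>j<n. q j \<le> s j \<and> s j \<le> q j + 1) \<and> label r i \<noteq> label s i"
      by (rule kuhn_lemma[of p n label]) (auto simp: label_def p_def)
    have cell_near: "near N (pt q) (pt r)"
      if "\<forall>j<n. q j \<le> r j \<and> r j \<le> q j + 1" for r
      unfolding near_def p_def[symmetric]
    proof
      show "pt r \<in> K" using that q by (intro ptK) fastforce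
      show "\<forall>j. \<bar>pt r j - pt q j\<bar> \<le> inverse (real p)"
      proof
        fix j
        show "\<bar>pt r j - pt q j\<bar> \<le> inverse (real p)"
        proof (cases "j < n")
          case True
          then have "real (r j) - real (q j) \<in> {0..1}" using that by force
          then have "(real (r j) - real (q j)) / p \<in> {0..1 / p}"
            by (auto simp: p_def divide_right_mono)
          then show ?thesis using True by (simp add: pt_def diff_divide_distrib inverse_eq_divide)
        qed (simp add: pt_def)
      qed
    qed
    have lab0: "pt r i \<le> g (pt r) i" if "label r i = 0" "pt r \<in> K" "i < n" for r i
      using that g01[of "pt r" i] by (auto simp: label_def pt_def split: if_splits)
    have lab1: "g (pt r) i \<le> pt r i" if "label r i \<noteq> 0" "pt r \<in> K" "i < n" for r i
      using that g01[of "pt r" i] by (auto simp: label_def pt_def p_def split: if_splits)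
    have "(\<exists>r. near N (pt q) r \<and> r i \<le> g r i) \<and> (\<exists>s. near N (pt q) s \<and> g s i \<le> s i)"
      if i: "i < n" for i
    proof -
      from rs i have "\<exists>r s. (\<forall>j<n. q j \<le> r j \<and> r j \<le> q j + 1) \<and>
        (\<forall>j<n. q j \<le> s j \<and> s j \<le> q j + 1) \<and> label r i \<noteq> label s i" by simp
      then obtain r s where r: "\<forall>j<n. q j \<le> r j \<and> r j \<le> q j + 1"
        and s: "\<forall>j<n. q j \<le> s j \<and> s j \<le> q j + 1" and ne: "label r i \<noteq> label s i"
        by (elim exE conjE) (rule that)
      have K: "pt r \<in> K" "pt s \<in> K" using cell_near r s by (auto simp: near_def)
      show ?thesis
      proof (cases "label r i = 0")
        case True
        then show ?thesis using cell_near[OF r] cell_near[OF s] lab0[of r i] lab1[of s i] ne i K by metis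
      next
        case False
        then have "label s i = 0" using ne unfolding label_def by presburger
        then show ?thesis using cell_near[OF r] cell_near[OF s] lab0[of s i] lab1[of r i] False i K by metis
      qed
    qed
    moreover have "pt q \<in> K" using q by (intro ptK) (simp add: less_imp_le)
    ultimately show ?thesis by blast
  qed
  define good where "good N x \<longleftrightarrow>
    (\<forall>i<n. (\<exists>r. near N x r \<and> r i \<le> g r i) \<and> (\<exists>s. near N x s \<and> g s i \<le> s i))" for N x
  have "\<forall>N. \<exists>x. x \<in> K \<and> good N x" using cell unfolding good_def Bex_def by (rule allI)
  then obtain x where "\<forall>N. x N \<in> K \<and> good N (x N)" by (rule choice[THEN exE])
  then have xK: "\<And>N. x N \<in> K" and xgood: "\<And>N. good N (x N)" by auto
  have "compact K" unfolding K_def by (rule compact_PiE_UNIV) simp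
  then obtain y k where y: "y \<in> K" "strict_mono (k::nat\<Rightarrow>nat)" "(x \<circ> k) \<longlonglongrightarrow> y"
    using xK unfolding compact_eq_seq_compact_metric seq_compact_def by meson
  have inv0: "(\<lambda>N. inverse (real (Suc (k N)))) \<longlonglongrightarrow> 0"
    using LIMSEQ_subseq_LIMSEQ[OF LIMSEQ_inverse_real_of_nat y(2)] by (simp add: o_def)
  have xlim: "(\<lambda>N. x (k N) j) \<longlonglongrightarrow> y j" for j
    using tendsto_fun_component[OF y(3), of j] by (simp add: o_def)
  \<comment> \<open>Witnesses within \<open>inverse (Suc N)\<close> of \<open>x N\<close> share the
    limit \<open>y\<close>, so continuity of \<open>g\<close> carries the inequalities over to
    \<open>y\<close>.\<close>
  have glim: "(\<lambda>N. w (k N) i) \<longlonglongrightarrow> y i \<and> (\<lambda>N. g (w (k N)) i) \<longlonglongrightarrow> g y i"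
    if w: "\<And>N. near N (x N) (w N)" for w i
  proof -
    have wl: "(\<lambda>N. w (k N) j) \<longlonglongrightarrow> y j" for j
    proof -
      have "(\<lambda>N. w (k N) j - x (k N) j) \<longlonglongrightarrow> 0"
        by (rule Lim_null_comparison[OF _ inv0]) (use w in \<open>auto simp: near_def\<close>)
      from tendsto_add[OF this xlim[of j]] show ?thesis by simp
    qed
    then have "(\<lambda>N. w (k N)) \<longlonglongrightarrow> y" by (rule tendsto_funI)
    then have "(\<lambda>N. g (w (k N))) \<longlonglongrightarrow> g y"
      by (rule continuous_on_tendsto_compose[OF cont]) (use w y in \<open>auto simp: near_def\<close>)
    then have "(\<lambda>N. g (w (k N)) i) \<longlonglongrightarrow> g y i" by (rule tendsto_fun_component)
    with wl[of i] show ?thesis by (rule conjI)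
  qed
  have "g y i = y i" if i: "i < n" for i
  proof (rule antisym)
    have "\<forall>N. \<exists>r. near N (x N) r \<and> r i \<le> g r i" using xgood i by (auto simp: good_def)
    then obtain w where "\<forall>N. near N (x N) (w N) \<and> w N i \<le> g (w N) i" by (rule choice[THEN exE])
    then show "y i \<le> g y i" using glim[of w i] by (intro LIMSEQ_le[of "\<lambda>N. w (k N) i" _ "\<lambda>N. g (w (k N)) i"]) auto
    have "\<forall>N. \<exists>s. near N (x N) s \<and> g s i \<le> s i" using xgood i by (auto simp: good_def)
    then obtain w where "\<forall>N. near N (x N) (w N) \<and> g (w N) i \<le> w N i" by (rule choice[THEN exE])
    then show "g y i \<le> y i" using glim[of w i] by (intro LIMSEQ_le[of "\<lambda>N. g (w (k N)) i" _ "\<lambda>N. w (k N) i"]) auto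
  qed
  then show ?thesis using y by blast
qed

section \<open>Schauder's theorem\<close>

text \<open>A partition of unity over a finite \<open>e\<close>-net reduces the claim to Brouwer's
  theorem: at the fixed point \<open>y\<close>, the weights of the net points at
  \<open>f (p y)\<close> are the barycentric coordinates of \<open>p y\<close>. Only net points
  closer than \<open>e\<close> to \<open>f (p y)\<close> carry weight.\<close>

lemma schauder_approx:
  fixes f :: "'a::real_normed_vector \<Rightarrow> 'a"
  assumes S: "compact S" "convex S" and ne: "S \<noteq> {}"
    and cont: "continuous_on S f" and fS: "f ` S \<subseteq> S" and e: "e > 0"
  shows "\<exists>x\<in>S. norm (f x - x) < e"
proof -
  obtain A where A: "finite A" "A \<subseteq> S" "S \<subseteq> (\<Union>x\<in>A. ball x e)"
    using compactE_image[OF S(1), of S "\<lambda>x. ball x e"] e by (metis open_ball UN_I centre_in_ball subsetI)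
  then have "A \<noteq> {}" using ne by auto
  obtain n c where c: "A = c ` {..<n::nat}" using finite_imp_nat_seg_image_inj_on[OF A(1)] by (auto simp: lessThan_def)
  have n: "n > 0" using \<open>A \<noteq> {}\<close> c by (cases n) auto
  have cS: "c i \<in> S" if "i < n" for i using that A c by auto
  \<comment> \<open>Tent functions, positive exactly within distance \<open>e\<close> of
    \<open>c i\<close>; divided by \<open>H\<close> they form a partition of unity on
    \<open>S\<close>.\<close>
  define h where "h i x = max 0 (e - dist (c i) x)" for i x
  define H where "H x = (\<Sum>i<n. h i x)" for x
  have h0: "h i x \<ge> 0" for i x by (simp add: h_def)
  have Hpos: "H x > 0" if "x \<in> S" for x
  proof -
    have "x \<in> (\<Union>z\<in>A. ball z e)" using A(3) that by (rule subsetD)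
    then obtain i where "i < n" "dist (c i) x < e" unfolding c by auto
    then have "h i x > 0" by (simp add: h_def)
    then show ?thesis unfolding H_def using \<open>i < n\<close> h0 by (intro sum_pos2[of _ i]) auto
  qed
  define K :: "(nat \<Rightarrow> real) set" where "K = PiE UNIV (\<lambda>_. {0..1})"
  define \<sigma> :: "(nat \<Rightarrow> real) \<Rightarrow> real" where "\<sigma> y = (\<Sum>i<n. y i)" for y
  \<comment> \<open>\<open>p\<close> extends the barycentric map of the simplex \<open>\<sigma> y = 1\<close> to the whole cube, with values in \<open>S\<close>.\<close>
  define p where "p y = (1 / max 1 (\<sigma> y)) *\<^sub>R ((\<Sum>i<n. y i *\<^sub>R c i) + max 0 (1 - \<sigma> y) *\<^sub>R c 0)" for y
  have pS: "p y \<in> S" if y: "y \<in> K" for y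
  proof -
    \<comment> \<open>If the coordinates sum to less than 1, the missing mass goes to
      \<open>c 0\<close>; if they sum to more, the weights are rescaled.\<close>
    define w where "w i = (y i + (if i = 0 then max 0 (1 - \<sigma> y) else 0)) / max 1 (\<sigma> y)" for i
    have "p y = (\<Sum>i<n. w i *\<^sub>R c i)"
    proof -
      have "(\<Sum>i<n. (if i = 0 then max 0 (1 - \<sigma> y) else 0) *\<^sub>R c i) = max 0 (1 - \<sigma> y) *\<^sub>R c 0"
        using n by (subst sum.remove[of _ 0]) auto
      then have "p y = (1 / max 1 (\<sigma> y)) *\<^sub>R
          (\<Sum>i<n. (y i + (if i = 0 then max 0 (1 - \<sigma> y) else 0)) *\<^sub>R c i)"
        by (simp add: p_def scaleR_add_left sum.distrib)
      then show ?thesis by (simp add: w_def scaleR_sum_right)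
    qed
    moreover have "(\<Sum>i<n. w i) = 1"
    proof -
      have "(\<Sum>i<n. y i + (if i = 0 then max 0 (1 - \<sigma> y) else 0)) = \<sigma> y + max 0 (1 - \<sigma> y)"
        using n by (simp add: sum.distrib \<sigma>_def)
      then show ?thesis unfolding w_def sum_divide_distrib[symmetric] by (simp add: max_def)
    qed
    moreover have "w i \<ge> 0" for i using y by (auto simp: w_def K_def PiE_iff)
    ultimately show ?thesis using convex_sum[of "{..<n}" S w c] S(2) cS by simp
  qed
  have "continuous_on K p"
    unfolding p_def \<sigma>_def
    by (intro continuous_intros continuous_on_subset[OF continuous_on_product_coordinates]) auto
  then have fp: "continuous_on K (\<lambda>y. f (p y))"
    by (rule continuous_on_compose2[OF cont]) (use pS in auto)
  define g where "g y i = h i (f (p y)) / H (f (p y))" for y i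
  have "\<exists>y\<in>PiE UNIV (\<lambda>_. {0..1}). \<forall>i<n. g y i = y i"
  proof (rule brouwer_cube_nat)
    have "continuous_on K (\<lambda>y. h i (f (p y)) / H (f (p y)))" for i
      unfolding H_def h_def
    proof (intro continuous_intros fp ballI)
      show "(\<Sum>i<n. max 0 (e - dist (c i) (f (p x)))) \<noteq> 0" if "x \<in> K" for x
        using Hpos[of "f (p x)"] pS[OF that] fS by (auto simp: H_def h_def)
    qed
    then show "continuous_on (PiE UNIV (\<lambda>_. {0..1})) g"
      unfolding K_def[symmetric] g_def by (intro continuous_on_coordinatewise_then_product)
    show "g y i \<in> {0..1}" if "y \<in> PiE UNIV (\<lambda>_. {0..1})" "i < n" for y i
    proof -
      have "H (f (p y)) > 0" using that pS[of y] fS by (intro Hpos) (auto simp: K_def)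
      moreover have "h i (f (p y)) \<le> H (f (p y))"
        unfolding H_def using that h0 by (intro member_le_sum) auto
      ultimately show ?thesis using h0 by (simp add: g_def)
    qed
  qed
  then obtain y where y: "y \<in> K" "\<And>i. i < n \<Longrightarrow> g y i = y i" by (auto simp: K_def)
  define z where "z = f (p y)"
  have z: "z \<in> S" using fS pS[OF y(1)] by (auto simp: z_def)
  \<comment> \<open>The weights of a partition of unity sum to 1, so the fixed point lies on the
    simplex, where \<open>p y\<close> is the plain barycentric combination.\<close>
  have \<sigma>: "\<sigma> y = 1"
  proof -
    have "\<sigma> y = (\<Sum>i<n. h i z / H z)" unfolding \<sigma>_def using y(2) by (intro sum.cong) (auto simp: g_def z_def)
    also have "\<dots> = 1" using Hpos[OF z] by (simp add: H_def flip: sum_divide_distrib)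
    finally show ?thesis .
  qed
  have "z - p y = (\<Sum>i<n. y i *\<^sub>R (z - c i))"
    using \<sigma> by (simp add: p_def scaleR_diff_right sum_subtractf \<sigma>_def flip: scaleR_sum_left)
  also have "norm \<dots> \<le> (\<Sum>i<n. norm (y i *\<^sub>R (z - c i)))" by (rule norm_sum)
  \<comment> \<open>A positive \<open>y i\<close> comes from a positive tent value, which puts
    \<open>c i\<close> within \<open>e\<close> of \<open>z\<close>; some \<open>y i\<close> is
    positive because their sum is 1.\<close>
  also have "\<dots> < (\<Sum>i<n. y i * e)"
  proof (rule sum_strict_mono_ex1)
    have *: "norm (y i *\<^sub>R (z - c i)) \<le> y i * e \<and> (y i > 0 \<longrightarrow> norm (y i *\<^sub>R (z - c i)) < y i * e)" if "i < n" for i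
    proof (cases "y i > 0")
      case True
      then have "h i z > 0" using y(2)[OF that] h0[of i z] by (cases "h i z = 0") (auto simp: g_def z_def)
      then have "norm (z - c i) < e" by (auto simp: h_def dist_norm norm_minus_commute split: if_splits)
      then show ?thesis using True by simp
    next
      case False
      then have "y i = 0" using y(1) by (auto simp: K_def PiE_iff) (meson dual_order.antisym not_less)
      then show ?thesis by simp
    qed
    then show "\<forall>i\<in>{..<n}. norm (y i *\<^sub>R (z - c i)) \<le> y i * e" by auto
    have "\<exists>i<n. y i > 0"
    proof (rule ccontr)
      assume "\<not> ?thesis"
      then have "\<sigma> y \<le> 0" unfolding \<sigma>_def by (intro sum_nonpos) (use not_less in blast)
      then show False using \<sigma> by simp
    qed
    then show "\<exists>i\<in>{..<n}. norm (y i *\<^sub>R (z - c i)) < y i * e" using * by blast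
  qed simp
  also have "\<dots> = e" using \<sigma> by (simp add: \<sigma>_def flip: sum_distrib_right)
  finally have "norm (f (p y) - p y) < e" by (simp add: z_def)
  then show ?thesis using pS[OF y(1)] by blast
qed

text \<open>The displacement attains its minimum on the compact set; a positive minimum would
  contradict \<open>schauder_approx\<close> with that number as \<open>e\<close>.\<close>

theorem schauder:
  fixes f :: "'a::real_normed_vector \<Rightarrow> 'a"
  assumes S: "compact S" "convex S" "S \<noteq> {}" and cont: "continuous_on S f" and fS: "f ` S \<subseteq> S"
  shows "\<exists>x\<in>S. f x = x"
proof -
  have "continuous_on S (\<lambda>x. norm (f x - x))" by (intro continuous_intros cont)
  then obtain x where x: "x \<in> S" "\<And>y. y \<in> S \<Longrightarrow> norm (f x - x) \<le> norm (f y - y)"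
    using continuous_attains_inf[OF S(1,3)] by meson
  then have "\<not> norm (f x - x) > 0" using schauder_approx[OF S cont fS] by (meson not_less)
  then show ?thesis using x(1) by auto
qed

section \<open>Compact convex sets of periodic functions\<close>

definition lip_periodic :: "real \<Rightarrow> real \<Rightarrow> real \<Rightarrow> real \<Rightarrow> real \<Rightarrow> (real \<Rightarrow> real) set" where
  "lip_periodic T L C a c = {z. (\<forall>t. z (t + T) = z t) \<and> (\<forall>s t. \<bar>z s - z t\<bar> \<le> L * \<bar>s - t\<bar>) \<and>
     (\<forall>s t. \<bar>z s - z t\<bar> \<le> C) \<and> a \<le> z 0 \<and> z 0 \<le> c}"

lemma lip_periodic_bcontfun:
  assumes "z \<in> lip_periodic T L C a c" "L \<ge> 0"
  shows "z \<in> bcontfun"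
proof (rule bcontfun_normI)
  have "L-lipschitz_on UNIV z"
    using assms by (intro lipschitz_onI) (auto simp: lip_periodic_def dist_real_def)
  then show "continuous_on UNIV z" by (rule lipschitz_on_continuous_on)
  show "norm (z t) \<le> \<bar>a\<bar> + \<bar>c\<bar> + C" for t
  proof -
    have "\<bar>z t - z 0\<bar> \<le> C" "a \<le> z 0" "z 0 \<le> c" using assms by (auto simp: lip_periodic_def)
    then show ?thesis by auto
  qed
qed

lemma convex_lip_periodic: "convex {f :: real \<Rightarrow>\<^sub>C real. apply_bcontfun f \<in> lip_periodic T L C a c}"
proof (rule convexI)
  fix f g :: "real \<Rightarrow>\<^sub>C real" and u v :: real
  assume "f \<in> {f. apply_bcontfun f \<in> lip_periodic T L C a c}" "g \<in> {f. apply_bcontfun f \<in> lip_periodic T L C a c}"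
    and uv: "0 \<le> u" "0 \<le> v" "u + v = 1"
  then have f: "apply_bcontfun f \<in> lip_periodic T L C a c" and g: "apply_bcontfun g \<in> lip_periodic T L C a c" by auto
  have D: "\<bar>(u * f s + v * g s) - (u * f t + v * g t)\<bar> \<le> B"
    if "\<bar>f s - f t\<bar> \<le> B" "\<bar>g s - g t\<bar> \<le> B" for s t B
  proof -
    have "\<bar>(u * f s + v * g s) - (u * f t + v * g t)\<bar> = \<bar>u * (f s - f t) + v * (g s - g t)\<bar>"
      by (simp add: algebra_simps)
    also have "\<dots> \<le> u * \<bar>f s - f t\<bar> + v * \<bar>g s - g t\<bar>"
      using uv by (metis abs_mult abs_of_nonneg abs_triangle_ineq)
    also have "\<dots> \<le> B" by (rule convex_bound_le[OF that uv])
    finally show ?thesis .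
  qed
  have "a \<le> u * f 0 + v * g 0"
    using convex_bound_le[of "- f 0" "-a" "- g 0" u v] f g uv by (simp add: lip_periodic_def)
  moreover have "u * f 0 + v * g 0 \<le> c"
    using convex_bound_le[of "f 0" c "g 0" u v] f g uv by (simp add: lip_periodic_def)
  ultimately show "u *\<^sub>R f + v *\<^sub>R g \<in> {f. apply_bcontfun f \<in> lip_periodic T L C a c}"
    using D f g by (simp add: lip_periodic_def plus_bcontfun.rep_eq scaleR_bcontfun.rep_eq)
qed

text \<open>Arzela-Ascoli on one period gives a uniformly convergent subsequence; periodicity makes
  the convergence uniform on the whole line, and all conditions pass to pointwise limits.\<close>

lemma compact_lip_periodic:
  assumes "T > 0" and L: "L \<ge> 0"
  shows "compact {f :: real \<Rightarrow>\<^sub>C real. apply_bcontfun f \<in> lip_periodic T L C a c}"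
    (is "compact ?S")
  unfolding compact_eq_seq_compact_metric seq_compact_def
proof (intro allI impI)
  fix X :: "nat \<Rightarrow> real \<Rightarrow>\<^sub>C real"
  assume "\<forall>n. X n \<in> ?S"
  then have X: "apply_bcontfun (X n) \<in> lip_periodic T L C a c" for n by auto
  obtain l k where k: "strict_mono (k :: nat \<Rightarrow> nat)"
    and lk: "\<And>e. 0 < e \<Longrightarrow> \<exists>N. \<forall>n x. n \<ge> N \<and> x \<in> {0..T} \<longrightarrow> norm (X (k n) x - l x) < e"
  proof (rule Arzela_Ascoli[of "{0..T}" "\<lambda>n. apply_bcontfun (X n)" "\<bar>a\<bar> + \<bar>c\<bar> + C"])
    show "norm (X n x) \<le> \<bar>a\<bar> + \<bar>c\<bar> + C" for n x
    proof -
      have "\<bar>X n x - X n 0\<bar> \<le> C" "a \<le> X n 0" "X n 0 \<le> c" using X[of n] by (auto simp: lip_periodic_def)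
      then show ?thesis by auto
    qed
    show "\<exists>d>0. \<forall>n y. y \<in> {0..T} \<and> norm (x - y) < d \<longrightarrow> norm (X n x - X n y) < e" if "0 < e" for x e
    proof (intro exI conjI allI impI)
      \<comment> \<open>The \<open>+ 1\<close> keeps the quotient meaningful when
        \<open>L = 0\<close>.\<close>
      show "e / (L + 1) > 0" using that L by simp
      fix n y assume "y \<in> {0..T} \<and> norm (x - y) < e / (L + 1)"
      then have "(L + 1) * \<bar>x - y\<bar> < e" using L by (simp add: pos_less_divide_eq mult.commute)
      moreover have "\<bar>X n x - X n y\<bar> \<le> L * \<bar>x - y\<bar>" using X[of n] by (simp add: lip_periodic_def)
      moreover have "L * \<bar>x - y\<bar> \<le> (L + 1) * \<bar>x - y\<bar>" by (intro mult_right_mono) auto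
      ultimately show "norm (X n x - X n y) < e" by simp
    qed
  qed auto
  define red where "red t = t - of_int \<lfloor>t / T\<rfloor> * T" for t
  have red: "red t \<in> {0..T}" for t
    using floor_divide_lower[OF \<open>T > 0\<close>, of t] floor_divide_upper[OF \<open>T > 0\<close>, of t]
    by (simp add: red_def algebra_simps)
  have Xred: "X n (red t) = X n t" for n t
  proof -
    interpret periodic_fun_simple "apply_bcontfun (X n)" T
      using X[of n] by unfold_locales (simp add: lip_periodic_def)
    show ?thesis unfolding red_def by (rule minus_of_int)
  qed
  have "uniform_limit UNIV (\<lambda>n. apply_bcontfun (X (k n))) (\<lambda>t. l (red t)) sequentially"
    unfolding uniform_limit_sequentially_iff
  proof (intro allI impI)
    fix e :: real assume "e > 0"
    from lk[OF this] obtain N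
      where N: "\<forall>n x. n \<ge> N \<and> x \<in> {0..T} \<longrightarrow> norm (X (k n) x - l x) < e" by blast
    have "dist (X (k n) t) (l (red t)) < e" if "n \<ge> N" for n t
    proof -
      have "norm (X (k n) (red t) - l (red t)) < e" using N that red by blast
      then show ?thesis by (simp add: Xred dist_norm)
    qed
    then show "\<exists>N. \<forall>n\<ge>N. \<forall>t\<in>UNIV. dist (X (k n) t) (l (red t)) < e" by blast
  qed
  then obtain f :: "real \<Rightarrow>\<^sub>C real" where f: "(\<lambda>n. X (k n)) \<longlonglongrightarrow> f"
    by (rule uniform_limit_bcontfunE) simp
  have lim: "(\<lambda>n. X (k n) t) \<longlonglongrightarrow> f t" for t
    using tendsto_bcontfun_uniform_limit[OF f] by (rule tendsto_uniform_limitI) simp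
  have "apply_bcontfun f \<in> lip_periodic T L C a c"
    unfolding lip_periodic_def
  proof (intro CollectI conjI allI)
    fix s t
    show "f (t + T) = f t"
      using LIMSEQ_unique[OF lim[of "t + T"]] lim[of t] X by (simp add: lip_periodic_def)
    show "\<bar>f s - f t\<bar> \<le> L * \<bar>s - t\<bar>" "\<bar>f s - f t\<bar> \<le> C"
      by (rule LIMSEQ_le_const2[OF tendsto_rabs[OF tendsto_diff[OF lim lim]]];
          use X in \<open>auto simp: lip_periodic_def\<close>)+
    show "a \<le> f 0" by (rule LIMSEQ_le_const[OF lim]) (use X in \<open>auto simp: lip_periodic_def\<close>)
    show "f 0 \<le> c" by (rule LIMSEQ_le_const2[OF lim]) (use X in \<open>auto simp: lip_periodic_def\<close>)
  qed
  then show "\<exists>f\<in>?S. \<exists>k. strict_mono (k :: nat \<Rightarrow> nat) \<and> (X \<circ> k) \<longlonglongrightarrow> f"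
    using k f by (auto simp: o_def)
qed

lemma lip_periodic_fixpoint:
  fixes F :: "(real \<Rightarrow> real) \<Rightarrow> real \<Rightarrow> real"
  assumes "T > 0" "L \<ge> 0" "C \<ge> 0" "a \<le> c"
    and maps: "\<And>z. z \<in> lip_periodic T L C a c \<Longrightarrow> F z \<in> lip_periodic T L C a c"
    and lip: "\<And>z w d t. z \<in> lip_periodic T L C a c \<Longrightarrow> w \<in> lip_periodic T L C a c \<Longrightarrow>
      (\<And>t. \<bar>z t - w t\<bar> \<le> d) \<Longrightarrow> \<bar>F z t - F w t\<bar> \<le> K * d"
  shows "\<exists>z\<in>lip_periodic T L C a c. F z = z"
proof -
  let ?S = "{f :: real \<Rightarrow>\<^sub>C real. apply_bcontfun f \<in> lip_periodic T L C a c}"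
  define \<Phi> where "\<Phi> f = Bcontfun (F (apply_bcontfun f))" for f
  have \<Phi>: "apply_bcontfun (\<Phi> f) = F (apply_bcontfun f)" if "f \<in> ?S" for f
    unfolding \<Phi>_def using that maps lip_periodic_bcontfun[OF _ \<open>L \<ge> 0\<close>] by (intro Bcontfun_inverse) blast
  have "(\<lambda>t. a) \<in> lip_periodic T L C a c" using assms by (auto simp: lip_periodic_def)
  then have "const_bcontfun a \<in> ?S" by (simp add: const_bcontfun.rep_eq)
  moreover have "\<Phi> ` ?S \<subseteq> ?S" using \<Phi> maps by auto
  moreover have "(max K 0)-lipschitz_on ?S \<Phi>"
  proof (rule lipschitz_onI)
    fix f g assume fg: "f \<in> ?S" "g \<in> ?S"
    show "dist (\<Phi> f) (\<Phi> g) \<le> max K 0 * dist f g"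
    proof (rule dist_bound)
      fix t
      have "\<bar>F f t - F g t\<bar> \<le> K * dist f g"
        using fg dist_bounded[of f _ g] by (intro lip) (auto simp: dist_real_def)
      also have "\<dots> \<le> max K 0 * dist f g" by (intro mult_right_mono) auto
      finally show "dist (\<Phi> f t) (\<Phi> g t) \<le> max K 0 * dist f g"
        by (simp add: \<Phi>[OF fg(1)] \<Phi>[OF fg(2)] dist_real_def)
    qed
  qed simp
  then have "continuous_on ?S \<Phi>" by (rule lipschitz_on_continuous_on)
  ultimately obtain f where "f \<in> ?S" "\<Phi> f = f"
    using schauder[OF compact_lip_periodic convex_lip_periodic, of T L C a c \<Phi>] assms(1,2) by blast
  then have "F (apply_bcontfun f) = apply_bcontfun f" using \<Phi> by metis
  with \<open>f \<in> ?S\<close> show ?thesis by blast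
qed

section \<open>Periodic solutions of linear equations\<close>

definition cper :: "real \<Rightarrow> (real \<Rightarrow> real) \<Rightarrow> bool" where
  "cper T f \<longleftrightarrow> continuous_on UNIV f \<and> (\<forall>t. f (t + T) = f t)"

lemma cper_of_int:
  assumes "cper T f"
  shows "f (t + of_int k * T) = f t"
proof -
  interpret periodic_fun_simple f T using assms by unfold_locales (simp add: cper_def)
  show ?thesis by (rule plus_of_int)
qed

lemma ex_period_shift:
  fixes T :: real
  assumes "T > 0"
  shows "\<exists>k::int. t + of_int k * T \<in> {s..s + T}"
  using floor_divide_lower[OF assms, of "t - s"] floor_divide_upper[OF assms, of "t - s"]
  by (intro exI[of _ "- \<lfloor>(t - s) / T\<rfloor>"]) (simp add: algebra_simps)

lemma cper_attains_inf:
  assumes "T > 0" "cper T f"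
  obtains s where "\<And>t. f s \<le> f t"
proof -
  obtain s where "\<forall>t\<in>{0..T}. f s \<le> f t"
    using continuous_attains_inf[of "{0..T}" f] assms by (auto simp: cper_def intro: continuous_on_subset)
  moreover have "\<exists>t'\<in>{0..T}. f t = f t'" for t
    using ex_period_shift[OF assms(1), of t 0] cper_of_int[OF assms(2)] by (metis add_0)
  ultimately show ?thesis using that by metis
qed

lemma cper_uminus: "cper T f \<Longrightarrow> cper T (\<lambda>t. - f t)"
  by (auto simp: cper_def intro: continuous_intros)

lemma cper_bounds:
  assumes "T > 0" "cper T f"
  obtains l h where "\<And>t. l \<le> f t \<and> f t \<le> h" "l \<in> range f"
proof -
  obtain s where s: "\<And>t. f s \<le> f t" using cper_attains_inf[OF assms] by blast
  obtain s' where "\<And>t. - f s' \<le> - f t" using cper_attains_inf[OF assms(1) cper_uminus[OF assms(2)]] by blast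
  then show ?thesis using s by (intro that[of "f s" "f s'"]) auto
qed

lemma ex_antiderivative:
  fixes f :: "real \<Rightarrow> real"
  assumes "continuous_on UNIV f"
  obtains G where "\<And>t. (G has_real_derivative f t) (at t)"
proof -
  have "\<exists>F. \<forall>x. -\<infinity> < ereal x \<longrightarrow> ereal x < \<infinity> \<longrightarrow> (F has_vector_derivative f x) (at x)"
    using assms by (intro einterval_antiderivative) (auto simp: continuous_on_eq_continuous_at)
  then show ?thesis using that by (auto simp: has_real_derivative_iff_has_vector_derivative)
qed

text \<open>The difference has derivative 0. The factor \<open>q = 1\<close> serves for the
  antiderivative of \<open>b\<close>, and \<open>q = exp C\<close> for that of an integrand carrying
  the integrating factor.\<close>

lemma antiderivative_shift:
  fixes G :: "real \<Rightarrow> real"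
  assumes "\<And>t. (G has_real_derivative f t) (at t)" and "\<And>t. f (t + T) = q * f t"
  shows "G (t + T) - q * G t = G T - q * G 0"
proof -
  have "((\<lambda>t. G (t + T) - q * G t) has_real_derivative 0) (at t)" for t
    using assms(1)[of "t + T"] assms(2)[of t]
    by (auto intro!: derivative_eq_intros DERIV_chain'[of "\<lambda>t. t + T"] assms(1))
  from DERIV_isconst_all[of "\<lambda>t. G (t + T) - q * G t" t 0] this show ?thesis by simp
qed

lemma antiderivative_period:
  assumes "T > 0" "cper T b" and B: "\<And>t. (B has_real_derivative b t) (at t)"
  shows "B (t + T) = B t + integral {0..T} b"
proof -
  have "(b has_integral (B T - B 0)) {0..T}"
    using assms by (intro fundamental_theorem_of_calculus)
      (auto simp: has_real_derivative_iff_has_vector_derivative intro: has_vector_derivative_at_within)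
  then show ?thesis
    using antiderivative_shift[of B b T 1 t] assms by (simp add: cper_def integral_unique)
qed

text \<open>Variation of constants with the integrating factor \<open>exp (B t)\<close>; periodicity
  fixes the constant of integration, which is possible because \<open>C > 0\<close>.\<close>

lemma ex_periodic_linear_ode:
  assumes T: "T > 0" and b: "cper T b" "\<And>t. b t > 0" and g: "cper T g"
  shows "\<exists>y. (\<forall>t. (y has_real_derivative g t - b t * y t) (at t)) \<and> (\<forall>t. y (t + T) = y t)"
proof -
  obtain B where B: "\<And>t. (B has_real_derivative b t) (at t)"
    using ex_antiderivative b(1) unfolding cper_def by blast
  define C where "C = integral {0..T} b"
  have BT: "B (t + T) = B t + C" for t
    unfolding C_def by (rule antiderivative_period[OF T b(1) B])
  have "B 0 < B T" using T B b(2) by (intro DERIV_pos_imp_increasing[of 0 T B]) auto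
  then have C: "C > 0" using BT[of 0] by simp
  have "continuous_on UNIV B" using B by (meson DERIV_isCont continuous_at_imp_continuous_on)
  then have "continuous_on UNIV (\<lambda>t. exp (B t) * g t)"
    using g by (auto simp: cper_def intro!: continuous_intros)
  then obtain P where P: "\<And>t. (P has_real_derivative exp (B t) * g t) (at t)"
    using ex_antiderivative by blast
  have PT: "P (t + T) - exp C * P t = P T - exp C * P 0" for t
    by (rule antiderivative_shift[OF P]) (use g in \<open>simp add: BT exp_add cper_def\<close>)
  define D where "D = P T - exp C * P 0"
  \<comment> \<open>Chosen so that \<open>e + P (t + T) = exp C * (e + P t)\<close>, the condition
    for \<open>y\<close> to be periodic.\<close>
  define e where "e = D / (exp C - 1)"
  have e: "e + D = exp C * e" using C by (simp add: e_def field_simps)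
  define y where "y t = exp (- B t) * (e + P t)" for t
  have "(y has_real_derivative g t - b t * y t) (at t)" for t
    unfolding y_def by (auto intro!: derivative_eq_intros B P simp: algebra_simps exp_minus)
  moreover have "y (t + T) = y t" for t
  proof -
    have "e + P (t + T) = exp C * (e + P t)" using PT[of t] e by (simp add: D_def algebra_simps)
    then show ?thesis by (simp add: y_def BT exp_minus exp_add exp_diff)
  qed
  ultimately show ?thesis by blast
qed

text \<open>At a minimum \<open>s\<close> of \<open>y\<close> the derivative vanishes, so
  \<open>b s * y s = h s\<close> decides the sign.\<close>

lemma periodic_linear_ode_nonneg:
  assumes T: "T > 0" and b: "\<And>t. b t > 0" and y: "\<And>t. (y has_real_derivative h t - b t * y t) (at t)"
    and per: "\<And>t. y (t + T) = y t"
  shows "(\<And>t. h t \<ge> 0) \<Longrightarrow> y t \<ge> 0" and "(\<And>t. h t > 0) \<Longrightarrow> y t > 0"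
proof -
  have "cper T y" using y per by (auto simp: cper_def intro: DERIV_isCont continuous_at_imp_continuous_on)
  then obtain s where s: "\<And>t. y s \<le> y t" using cper_attains_inf[OF T] by blast
  have "h s - b s * y s = 0" by (rule DERIV_local_min[OF y, of 1]) (use s in auto)
  then have *: "h s = b s * y s" by simp
  show "y t \<ge> 0" if "\<And>t. h t \<ge> 0"
    using that[of s] * b[of s] s[of t] by (simp add: zero_le_mult_iff)
  show "y t > 0" if "\<And>t. h t > 0"
    using that[of s] * b[of s] s[of t] by (simp add: zero_less_mult_iff)
qed

lemma periodic_linear_ode_mono:
  assumes T: "T > 0" and b: "\<And>t. b t > 0"
    and y: "\<And>t. (y has_real_derivative g t - b t * y t) (at t)" "\<And>t. y (t + T) = y t"
    and w: "\<And>t. (w has_real_derivative k t - b t * w t) (at t)" "\<And>t. w (t + T) = w t"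
  shows "(\<And>t. g t \<le> k t) \<Longrightarrow> y t \<le> w t" and "(\<And>t. g t < k t) \<Longrightarrow> y t < w t"
proof -
  have d: "((\<lambda>t. w t - y t) has_real_derivative (k t - g t) - b t * (w t - y t)) (at t)" for t
    by (auto intro!: derivative_eq_intros y w simp: algebra_simps)
  show "(\<And>t. g t \<le> k t) \<Longrightarrow> y t \<le> w t" "(\<And>t. g t < k t) \<Longrightarrow> y t < w t"
    using periodic_linear_ode_nonneg[OF T b d, of t] y(2) w(2) by auto
qed

text \<open>Any choice gives the same function when \<open>T > 0\<close> and \<open>b\<close> is
  positive: \<open>periodic_linear_ode_mono\<close>, used in both directions, forces two periodic
  solutions to agree.\<close>

definition psol :: "real \<Rightarrow> (real \<Rightarrow> real) \<Rightarrow> (real \<Rightarrow> real) \<Rightarrow> real \<Rightarrow> real" where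
  "psol T b g = (SOME y. (\<forall>t. (y has_real_derivative g t - b t * y t) (at t)) \<and> (\<forall>t. y (t + T) = y t))"

lemma psol:
  assumes "T > 0" "cper T b" "\<And>t. b t > 0" "cper T g"
  shows "(psol T b g has_real_derivative g t - b t * psol T b g t) (at t)"
    and "psol T b g (t + T) = psol T b g t"
  using someI_ex[OF ex_periodic_linear_ode[OF assms]] unfolding psol_def by auto

text \<open>With \<open>B\<close> an antiderivative of \<open>b\<close>, the function
  \<open>ln y + B\<close> is nondecreasing, its derivative being \<open>g / y\<close>. Over one
  period \<open>B\<close> grows by \<open>integral {0..T} b\<close>, which therefore bounds any
  decrease of \<open>ln y\<close>.\<close>

lemma ln_psol_osc:
  assumes T: "T > 0" and b: "cper T b" "\<And>t. b t > 0" and g: "cper T g" "\<And>t. g t > 0"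
  shows "\<bar>ln (psol T b g s) - ln (psol T b g t)\<bar> \<le> integral {0..T} b"
proof -
  define y where "y = psol T b g"
  note y = psol[OF T b g(1), folded y_def]
  have y0: "y t > 0" for t using periodic_linear_ode_nonneg(2)[OF T b(2) y] g(2) .
  obtain B where B: "\<And>t. (B has_real_derivative b t) (at t)"
    using ex_antiderivative b(1) unfolding cper_def by blast
  have BT: "B (t + T) = B t + integral {0..T} b" for t
    by (rule antiderivative_period[OF T b(1) B])
  have incr: "ln (y s) + B s \<le> ln (y t) + B t" if "s \<le> t" for s t
  proof (rule DERIV_nonneg_imp_nondecreasing[OF that, of "\<lambda>t. ln (y t) + B t"])
    fix x
    have "((\<lambda>t. ln (y t) + B t) has_real_derivative g x / y x) (at x)"
      using y0[of x] by (auto intro!: derivative_eq_intros y B simp: field_simps)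
    moreover have "g x / y x \<ge> 0" using y0[of x] g(2)[of x] by simp
    ultimately show "\<exists>z. ((\<lambda>t. ln (y t) + B t) has_real_derivative z) (at x) \<and> 0 \<le> z" by blast
  qed
  have "ln (y s) - ln (y t) \<le> integral {0..T} b" for s t
  proof -
    \<comment> \<open>By periodicity \<open>t\<close> may be moved into the period starting at
      \<open>s\<close>, so that \<open>incr\<close> applies from \<open>s\<close> onward.\<close>
    obtain k where k: "t + of_int k * T \<in> {s..s + T}" using ex_period_shift[OF T] by blast
    have "cper T y" using y by (auto simp: cper_def intro: DERIV_isCont continuous_at_imp_continuous_on)
    then have "y (t + of_int k * T) = y t" by (rule cper_of_int)
    moreover have "B (t + of_int k * T) \<le> B (s + T)"
      using k B b(2) by (intro DERIV_nonneg_imp_nondecreasing[of _ _ B]) (auto intro: less_imp_le)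
    ultimately show ?thesis using incr[of s "t + of_int k * T"] k BT[of s] by simp
  qed
  from this[of s t] this[of t s] show ?thesis by (simp add: y_def abs_le_iff)
qed

section \<open>Minima of periodic functions\<close>

definition min_value :: "(real \<Rightarrow> real) \<Rightarrow> real" where "min_value u = Inf (range u)"

lemma min_value_attained:
  assumes "T > 0" "cper T u"
  obtains s where "min_value u = u s" "\<And>t. u s \<le> u t"
proof -
  obtain s where s: "\<And>t. u s \<le> u t" using cper_attains_inf[OF assms] by blast
  then have "min_value u = u s" unfolding min_value_def by (intro cInf_eq_minimum) auto
  with s show ?thesis using that by blast
qed

lemma min_value_lipschitz:
  assumes "T > 0" "cper T u" "cper T w" and d: "\<And>t. \<bar>u t - w t\<bar> \<le> d"
  shows "\<bar>min_value u - min_value w\<bar> \<le> d"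
proof -
  obtain s where s: "min_value u = u s" "\<And>t. u s \<le> u t" using min_value_attained[OF assms(1,2)] by blast
  obtain s' where s': "min_value w = w s'" "\<And>t. w s' \<le> w t" using min_value_attained[OF assms(1,3)] by blast
  show ?thesis using s s' s(2)[of s'] s'(2)[of s] d[of s] d[of s'] by linarith
qed

section \<open>The fixed point problem for the logarithm of a solution\<close>

lemma saturated_exp_mono:
  fixes m n :: real
  assumes "m > 0" "n > 0" "x \<le> x'" "y' \<le> y"
  shows "exp (m * x) / (1 + exp (n * y)) \<le> exp (m * x') / (1 + exp (n * y'))"
  using assms by (intro frac_le) (auto intro: add_pos_pos)

text \<open>Moving \<open>x\<close> and \<open>y\<close> by at most \<open>d\<close> changes the
  numerator by a factor of at most \<open>exp (m * d)\<close> and the denominator by one of at most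
  \<open>exp (n * d)\<close>. The estimate is multiplicative so that it becomes a Lipschitz bound
  for logarithms.\<close>

lemma saturated_exp_perturb:
  fixes m n :: real
  assumes "m > 0" "n > 0" "\<bar>x - x'\<bar> \<le> d" "\<bar>y - y'\<bar> \<le> d" "m + n \<le> \<kappa>"
  shows "exp (m * x) / (1 + exp (n * y)) \<le> exp (\<kappa> * d) * (exp (m * x') / (1 + exp (n * y')))"
proof -
  have d: "d \<ge> 0" using assms by linarith
  have "n * y' \<le> n * (y + d)" using assms by (intro mult_left_mono) auto
  then have "exp (n * y') \<le> exp (n * d) * exp (n * y)" by (simp add: distrib_left flip: exp_add)
  moreover have "1 \<le> exp (n * d)" using d assms by simp
  ultimately have *: "1 + exp (n * y') \<le> exp (n * d) * (1 + exp (n * y))"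
    unfolding distrib_left by linarith
  have "m * x \<le> m * (x' + d)" using assms by (intro mult_left_mono) auto
  then have "exp (m * x) \<le> exp (m * d) * exp (m * x')" by (simp add: distrib_left flip: exp_add)
  then have "exp (m * x) * (1 + exp (n * y')) \<le> exp (m * d) * exp (m * x') * (exp (n * d) * (1 + exp (n * y)))"
    using * by (intro mult_mono) (auto intro: add_nonneg_nonneg)
  also have "\<dots> = exp ((m + n) * d) * exp (m * x') * (1 + exp (n * y))"
    by (simp add: distrib_right exp_add)
  also have "\<dots> \<le> exp (\<kappa> * d) * exp (m * x') * (1 + exp (n * y))"
    using assms d by (intro mult_right_mono) (auto intro: mult_right_mono add_nonneg_nonneg)
  finally show ?thesis by (simp add: divide_simps add_pos_pos mult.assoc)
qed

locale delay_equation =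
  fixes T :: real and M :: nat
    and lam m n :: "nat \<Rightarrow> real"
    and r \<tau> \<mu> :: "nat \<Rightarrow> real \<Rightarrow> real"
    and b :: "real \<Rightarrow> real"
  assumes T: "T > 0" and M: "M \<ge> 1"
    and pos: "\<And>k. k \<in> {1..M} \<Longrightarrow> lam k > 0" "\<And>k. k \<in> {1..M} \<Longrightarrow> m k > 0" "\<And>k. k \<in> {1..M} \<Longrightarrow> n k > 0"
    and r: "\<And>k. k \<in> {1..M} \<Longrightarrow> cper T (r k)" "\<And>k t. k \<in> {1..M} \<Longrightarrow> r k t > 0"
    and \<tau>: "\<And>k. k \<in> {1..M} \<Longrightarrow> cper T (\<tau> k)"
    and \<mu>: "\<And>k. k \<in> {1..M} \<Longrightarrow> cper T (\<mu> k)"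
    and b: "cper T b" "\<And>t. b t > 0"
begin

definition C where "C = integral {0..T} b"

text \<open>The fraction of the equation in logarithmic variables: \<open>x\<close> is the logarithm
  of the state delayed by \<open>\<tau> k\<close>, and \<open>y\<close> of that delayed by
  \<open>\<mu> k\<close>.\<close>

definition sat :: "nat \<Rightarrow> real \<Rightarrow> real \<Rightarrow> real" where
  "sat k x y = exp (m k * x) / (1 + exp (n k * y))"

definition birth :: "(real \<Rightarrow> real) \<Rightarrow> real \<Rightarrow> real" where
  "birth u t = (\<Sum>k=1..M. lam k * r k t * sat k (u (t - \<tau> k t)) (u (t - \<mu> k t)))"

text \<open>
  \<open>lower p\<close> and \<open>upper p\<close> say that the constant \<open>exp p\<close> is a strict sub- and supersolution of
  \<open>y' = birth u - b y\<close> for every \<open>u\<close> with values in \<open>[p, p + C]\<close>.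
\<close>

definition lower :: "real \<Rightarrow> bool" where
  "lower p \<longleftrightarrow> (\<forall>t. b t * exp p < (\<Sum>k=1..M. lam k * r k t * sat k p (p + C)))"

definition upper :: "real \<Rightarrow> bool" where
  "upper p \<longleftrightarrow> (\<forall>t. (\<Sum>k=1..M. lam k * r k t * sat k (p + C) p) < b t * exp p)"

definition V :: "(real \<Rightarrow> real) \<Rightarrow> real \<Rightarrow> real" where
  "V u t = ln (psol T b (birth u) t)"

text \<open>For a periodic \<open>x\<close> this says that the minimum of \<open>x\<close> lies
  strictly between \<open>exp p\<close> and \<open>exp q\<close>; consecutive intervals thus give
  different solutions.\<close>

definition solution_between :: "real \<Rightarrow> real \<Rightarrow> bool" where
  "solution_between p q \<longleftrightarrow> (\<exists>x\<in>positive_periodic_solutions T M lam m n r \<tau> \<mu> b.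
     (\<forall>t. exp p < x t) \<and> (\<exists>t. x t < exp q))"

lemma sat_pos: "sat k x y > 0"
  by (simp add: sat_def add_pos_pos)

lemma sat_mono: "k \<in> {1..M} \<Longrightarrow> x \<le> x' \<Longrightarrow> y' \<le> y \<Longrightarrow> sat k x y \<le> sat k x' y'"
  unfolding sat_def using pos by (intro saturated_exp_mono)

lemma weight_pos: "k \<in> {1..M} \<Longrightarrow> lam k * r k t > 0"
  using pos r(2) by simp

lemma C_nonneg: "C \<ge> 0"
  unfolding C_def using b by (intro integral_nonneg)
    (auto simp: cper_def intro: less_imp_le integrable_continuous_interval continuous_on_subset)

lemma birth_cper:
  assumes "cper T u"
  shows "cper T (birth u)"
  unfolding cper_def
proof (intro conjI allI)
  have u: "continuous_on UNIV u" "\<And>t. u (t + T) = u t" using assms by (auto simp: cper_def)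
  have "continuous_on UNIV (\<lambda>t. u (t - f t))" if "cper T f" for f
    using that by (intro continuous_on_compose2[OF u(1)] continuous_intros) (auto simp: cper_def)
  then show "continuous_on UNIV (birth u)"
    unfolding birth_def sat_def using \<tau> \<mu> r
    by (intro continuous_intros) (auto simp: cper_def add_nonneg_eq_0_iff)
  have "u (t + T - s) = u (t - s)" for t s using u(2)[of "t - s"] by (simp add: algebra_simps)
  then show "birth u (t + T) = birth u t" for t
    unfolding birth_def using \<tau> \<mu> r by (intro sum.cong) (auto simp: cper_def)
qed

text \<open>\<open>sat\<close> increases in its first and decreases in its second argument, so its
  extreme values occur at opposite ends of \<open>[p, q]\<close>.\<close>

lemma birth_bounds:
  assumes u: "\<And>t. p \<le> u t \<and> u t \<le> q"
  shows "(\<Sum>k=1..M. lam k * r k t * sat k p q) \<le> birth u t"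
    and "birth u t \<le> (\<Sum>k=1..M. lam k * r k t * sat k q p)"
proof -
  show "(\<Sum>k=1..M. lam k * r k t * sat k p q) \<le> birth u t" "birth u t \<le> (\<Sum>k=1..M. lam k * r k t * sat k q p)"
    unfolding birth_def using u weight_pos by (intro sum_mono mult_left_mono sat_mono; simp add: less_imp_le)+
qed

lemma birth_pos: "birth u t > 0"
  unfolding birth_def using M by (intro sum_pos mult_pos_pos weight_pos sat_pos) auto

context
  fixes u assumes u: "cper T u"
begin

lemmas psol_birth = psol[OF T b birth_cper[OF u]]

lemma psol_birth_pos: "psol T b (birth u) t > 0"
  by (rule periodic_linear_ode_nonneg(2)[OF T b(2) psol_birth birth_pos])

lemma V_cper: "cper T (V u)"
proof -
  have "isCont (psol T b (birth u)) t" for t using psol_birth(1) by (rule DERIV_isCont)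
  then show ?thesis
    using psol_birth(2) psol_birth_pos unfolding cper_def V_def
    by (auto intro!: continuous_at_imp_continuous_on isCont_ln' simp: less_imp_neq[symmetric])
qed

lemma V_osc: "\<bar>V u s - V u t\<bar> \<le> C"
  unfolding V_def C_def by (rule ln_psol_osc[OF T b birth_cper[OF u] birth_pos])

lemma exp_V: "exp (V u t) = psol T b (birth u) t"
  using psol_birth_pos by (simp add: V_def)

lemma V_lower:
  assumes "lower p" "\<And>t. p \<le> u t \<and> u t \<le> p + C"
  shows "p < V u t"
proof -
  have "((\<lambda>t. exp p) has_real_derivative b t * exp p - b t * exp p) (at t)" for t by simp
  moreover have "b t * exp p < birth u t" for t
    using assms(1) birth_bounds(1)[where t = t, OF assms(2)] unfolding lower_def by (meson less_le_trans)
  ultimately have "exp p < psol T b (birth u) t"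
    by (intro periodic_linear_ode_mono(2)[OF T b(2) _ _ psol_birth]) auto
  then show ?thesis by (simp flip: exp_V)
qed

lemma V_upper:
  assumes "upper p" "\<And>t. p \<le> u t \<and> u t \<le> p + C"
  shows "V u t < p"
proof -
  have "((\<lambda>t. exp p) has_real_derivative b t * exp p - b t * exp p) (at t)" for t by simp
  moreover have "birth u t < b t * exp p" for t
    using assms(1) birth_bounds(2)[where t = t, OF assms(2)] unfolding upper_def by (meson le_less_trans)
  ultimately have "psol T b (birth u) t < exp p"
    by (intro periodic_linear_ode_mono(2)[OF T b(2) psol_birth]) auto
  then show ?thesis by (simp flip: exp_V)
qed

end

section \<open>Lipschitz estimates for the operator \<open>V\<close>\<close>

definition \<kappa> where "\<kappa> = (\<Sum>k=1..M. m k + n k)"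

text \<open>Each term of \<open>birth\<close> changes by a factor of at most
  \<open>exp (\<kappa> * d)\<close>. The linear equation preserves order and constant factors, so
  its solution inherits this bound; the logarithm turns the factor into a summand.\<close>

lemma V_perturb_le:
  assumes u: "cper T u" and w: "cper T w" and d: "\<And>t. \<bar>u t - w t\<bar> \<le> d"
  shows "V u t \<le> V w t + \<kappa> * d"
proof -
  have le: "birth u t \<le> exp (\<kappa> * d) * birth w t" for t
    unfolding birth_def sum_distrib_left
  proof (intro sum_mono)
    fix k assume k: "k \<in> {1..M}"
    have "m k + n k \<le> \<kappa>"
      unfolding \<kappa>_def using pos k by (intro member_le_sum) (auto intro!: add_nonneg_nonneg intro: less_imp_le)
    then have "sat k (u (t - \<tau> k t)) (u (t - \<mu> k t))
        \<le> exp (\<kappa> * d) * sat k (w (t - \<tau> k t)) (w (t - \<mu> k t))"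
      unfolding sat_def using pos k d by (intro saturated_exp_perturb) auto
    then have "lam k * r k t * sat k (u (t - \<tau> k t)) (u (t - \<mu> k t))
        \<le> lam k * r k t * (exp (\<kappa> * d) * sat k (w (t - \<tau> k t)) (w (t - \<mu> k t)))"
      using weight_pos[OF k] by (intro mult_left_mono) (auto intro: less_imp_le)
    then show "lam k * r k t * sat k (u (t - \<tau> k t)) (u (t - \<mu> k t))
        \<le> exp (\<kappa> * d) * (lam k * r k t * sat k (w (t - \<tau> k t)) (w (t - \<mu> k t)))"
      by (simp only: mult.left_commute)
  qed
  have d2: "((\<lambda>t. exp (\<kappa> * d) * psol T b (birth w) t) has_real_derivative
      exp (\<kappa> * d) * birth w t - b t * (exp (\<kappa> * d) * psol T b (birth w) t)) (at t)" for t
    by (auto intro!: derivative_eq_intros psol_birth[OF w] simp: algebra_simps)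
  have "psol T b (birth u) t \<le> exp (\<kappa> * d) * psol T b (birth w) t"
    by (rule periodic_linear_ode_mono(1)[OF T b(2) psol_birth[OF u] d2 _ le]) (simp add: psol_birth[OF w])
  then have "exp (V u t) \<le> exp (\<kappa> * d + V w t)"
    by (simp add: exp_V[OF u] exp_V[OF w] exp_add)
  then show ?thesis by simp
qed

lemma V_perturb:
  assumes "cper T u" "cper T w" "\<And>t. \<bar>u t - w t\<bar> \<le> d"
  shows "\<bar>V u t - V w t\<bar> \<le> \<kappa> * d"
  using V_perturb_le[OF assms, of t] V_perturb_le[OF assms(2,1), of d t] assms(3)
  by (simp add: abs_minus_commute abs_le_iff)

text \<open>On functions with values in \<open>[p, q]\<close> the forcing stays between constants
  \<open>G0 > 0\<close> and \<open>G1\<close>. Hence the solution is at least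
  \<open>G0 / bh\<close>, where \<open>bh\<close> bounds \<open>b\<close>, and the logarithmic
  derivative \<open>birth u / psol T b (birth u) - b\<close> is bounded uniformly.\<close>

lemma V_lipschitz:
  assumes "p \<le> q"
  obtains L where "L \<ge> 0"
    and "\<And>u s t. cper T u \<Longrightarrow> (\<And>t. p \<le> u t \<and> u t \<le> q) \<Longrightarrow> \<bar>V u s - V u t\<bar> \<le> L * \<bar>s - t\<bar>"
proof -
  have "\<forall>k. \<exists>l h. k \<in> {1..M} \<longrightarrow> l > 0 \<and> (\<forall>t. l \<le> r k t \<and> r k t \<le> h)"
    using cper_bounds[OF T r(1)] r(2) by (metis rangeE)
  then obtain l h where lh: "\<And>k. k \<in> {1..M} \<Longrightarrow> l k > 0 \<and> (\<forall>t. l k \<le> r k t \<and> r k t \<le> h k)"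
    by metis
  obtain bl bh where "\<And>t. bl \<le> b t \<and> b t \<le> bh" using cper_bounds[OF T b(1)] by metis
  then have bh: "b t \<le> bh" "bh > 0" for t using b(2)[of 0] by (auto intro: less_le_trans)
  define G0 where "G0 = (\<Sum>k=1..M. lam k * l k * sat k p q)"
  define G1 where "G1 = (\<Sum>k=1..M. lam k * h k * sat k q p)"
  have G0: "G0 > 0"
    unfolding G0_def using M pos lh by (intro sum_pos mult_pos_pos sat_pos) auto
  have G: "G0 \<le> birth u t" "birth u t \<le> G1" if "\<And>t. p \<le> u t \<and> u t \<le> q" for u t
  proof -
    have "G0 \<le> (\<Sum>k=1..M. lam k * r k t * sat k p q)"
      unfolding G0_def using pos lh sat_pos
      by (intro sum_mono mult_right_mono mult_left_mono; simp add: less_imp_le)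
    then show "G0 \<le> birth u t" using birth_bounds(1)[where u = u and t = t, OF that] by linarith
    have "(\<Sum>k=1..M. lam k * r k t * sat k q p) \<le> G1"
      unfolding G1_def using pos lh sat_pos
      by (intro sum_mono mult_right_mono mult_left_mono; simp add: less_imp_le)
    then show "birth u t \<le> G1" using birth_bounds(2)[where u = u and t = t, OF that] by linarith
  qed
  define L where "L = G1 * bh / G0 + bh"
  have "\<bar>V u s - V u t\<bar> \<le> L * \<bar>s - t\<bar>" if u: "cper T u" and pq: "\<And>t. p \<le> u t \<and> u t \<le> q" for u s t
  proof -
    have y: "G0 / bh \<le> psol T b (birth u) t" for t
    proof (rule periodic_linear_ode_mono(1)[OF T b(2) _ _ psol_birth[OF u]])
      show "((\<lambda>t. G0 / bh) has_real_derivative b t * (G0 / bh) - b t * (G0 / bh)) (at t)" for t by simp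
      show "b t * (G0 / bh) \<le> birth u t" for t
      proof -
        have "b t * (G0 / bh) \<le> bh * (G0 / bh)" using bh G0 by (intro mult_right_mono) auto
        then show ?thesis using G(1)[of u t, OF pq] bh(2) by simp
      qed
    qed simp
    have D: "(V u has_real_derivative birth u t / psol T b (birth u) t - b t) (at t)" for t
      unfolding V_def using psol_birth_pos[OF u, of t]
      by (auto intro!: derivative_eq_intros psol_birth[OF u] simp: field_simps)
    have B: "norm (birth u t / psol T b (birth u) t - b t) \<le> L" for t
    proof -
      have "birth u t / psol T b (birth u) t \<le> G1 / (G0 / bh)"
        using G[of u t, OF pq] y[of t] G0 bh(2) by (intro frac_le) (auto intro: order_trans[of 0 G0])
      moreover have "0 < birth u t / psol T b (birth u) t" using birth_pos psol_birth_pos[OF u] by simp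
      ultimately show ?thesis using b(2)[of t] bh(1)[of t] by (simp add: L_def abs_le_iff)
    qed
    show ?thesis
      using field_differentiable_bound[of UNIV "V u" "\<lambda>t. birth u t / psol T b (birth u) t - b t" L s t] D B
      by simp
  qed
  moreover have "G1 \<ge> 0" using G(1,2)[of "\<lambda>_. p" 0] assms G0 by simp
  then have "L \<ge> 0" using G0 bh(2) by (simp add: L_def)
  ultimately show ?thesis using that by blast
qed

text \<open>
  The set of all \<open>u\<close> with \<open>p \<le> min u \<le> q\<close> is not convex. Therefore \<open>u\<close> is encoded by its vertical
  translate \<open>z\<close> with \<open>z 0 = min u\<close>. The sign \<open>\<epsilon> = -1\<close> reflects the displacement of the minimum,
  turning a map that expands across \<open>[p, q]\<close> into a compressing one.
\<close>

definition reflected_step :: "real \<Rightarrow> real \<Rightarrow> real \<Rightarrow> (real \<Rightarrow> real) \<Rightarrow> real \<Rightarrow> real" where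
  "reflected_step \<epsilon> p q z = (let v = V (\<lambda>t. z t + (z 0 - min_value z)) in
     (\<lambda>t. v t - v 0 + max p (min q (z 0 + \<epsilon> * (min_value v - z 0)))))"

text \<open>At an endpoint the sign condition would move the clamped value off that endpoint, so
  \<open>z 0\<close> is interior and the clamp is inactive. Then the minima of \<open>u\<close> and
  \<open>V u\<close> agree; as the two functions differ by a constant,
  \<open>u = V u\<close>.\<close>

lemma fixpoint_solution:
  assumes z: "cper T z" and osc: "\<And>s t. \<bar>z s - z t\<bar> \<le> C" and fixp: "reflected_step \<epsilon> p q z = z"
    and pq: "p < q" "p \<le> z 0" "z 0 \<le> q" and \<epsilon>: "\<epsilon> = 1 \<and> lower p \<and> upper q \<or> \<epsilon> = -1 \<and> upper p \<and> lower q"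
  shows "solution_between p q"
proof -
  define u where "u = (\<lambda>t. z t + (z 0 - min_value z))"
  define v where "v = V u"
  have u: "cper T u" using z by (auto simp: u_def cper_def intro: continuous_intros)
  have v: "cper T v" unfolding v_def by (rule V_cper[OF u])
  have zv: "z t = v t - v 0 + max p (min q (z 0 + \<epsilon> * (min_value v - z 0)))" for t
    using fun_cong[OF fixp, of t] by (simp add: reflected_step_def Let_def u_def v_def)
  obtain s where s: "min_value z = z s" "\<And>t. z s \<le> z t" using min_value_attained[OF T z] by blast
  obtain s' where s': "min_value v = v s'" "\<And>t. v s' \<le> v t" using min_value_attained[OF T v] by blast
  have ub: "z 0 \<le> u t \<and> u t \<le> z 0 + C" for t using s s(2)[of t] osc[of t s] by (auto simp: u_def)
  have z0: "z 0 = max p (min q (z 0 + \<epsilon> * (min_value v - z 0)))" using zv[of 0] by simp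
  have lo: "min_value v > z 0" if "lower (z 0)" using V_lower[OF u that ub, of s'] s'(1) by (simp add: v_def)
  have up: "min_value v < z 0" if "upper (z 0)" using V_upper[OF u that ub, of s'] s'(1) by (simp add: v_def)
  have "z 0 \<noteq> p" using z0 lo up \<epsilon> pq by (auto simp: max_def min_def split: if_splits)
  moreover have "z 0 \<noteq> q" using z0 lo up \<epsilon> pq by (auto simp: max_def min_def split: if_splits)
  ultimately have in_pq: "p < z 0" "z 0 < q" using pq by auto
  then have "\<epsilon> * (min_value v - z 0) = 0" using z0 by (auto simp: max_def min_def split: if_splits)
  then have mnv: "min_value v = z 0" using \<epsilon> by auto
  have uv: "u t = v t" for t
  proof -
    have d: "u t = v t + (u 0 - v 0)" for t using zv[of t] zv[of 0] by (simp add: u_def)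
    have "u s = z 0" by (simp add: u_def s)
    then have "u 0 = v 0"
      using d[of s] d[of s'] ub[of s'] s'(1) s'(2)[of s] mnv by linarith
    then show ?thesis using d[of t] by simp
  qed
  define x where "x = psol T b (birth u)"
  have x: "x t = exp (u t)" for t using exp_V[OF u, of t] uv[of t] by (simp add: x_def v_def)
  have powr: "x t powr e = exp (e * u t)" for t e by (simp add: x powr_def)
  have "x \<in> positive_periodic_solutions T M lam m n r \<tau> \<mu> b"
    unfolding positive_periodic_solutions_def
  proof (intro CollectI conjI allI)
    show "periodic_fun_simple x T"
      by unfold_locales (simp add: x_def psol_birth(2)[OF u])
    show "x t > 0" for t by (simp add: x)
    have "(\<Sum>k=1..M. lam k * r k t * (x (t - \<tau> k t) powr m k) / (1 + x (t - \<mu> k t) powr n k)) = birth u t" for t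
      by (simp add: birth_def sat_def powr)
    then show "(x has_real_derivative (\<Sum>k=1..M. lam k * r k t * (x (t - \<tau> k t) powr m k) /
        (1 + x (t - \<mu> k t) powr n k)) - b t * x t) (at t)" for t
      using psol_birth(1)[OF u, of t] by (simp add: x_def)
  qed
  moreover have "exp p < x t" for t using ub[of t] in_pq by (simp add: x)
  moreover have "x s < exp q" using in_pq by (simp add: x u_def s)
  ultimately show ?thesis unfolding solution_between_def by blast
qed

text \<open>\<open>reflected_step\<close> maps \<open>lip_periodic T L C p q\<close> into itself:
  the clamp confines its value at 0 to \<open>[p, q]\<close>, and \<open>V\<close> supplies the
  bounds on oscillation and slope. Its fixed point is turned into a solution by
  \<open>fixpoint_solution\<close>.\<close>

theorem solution_between_lower_upper:
  assumes pq: "p < q" and \<epsilon>: "lower p \<and> upper q \<or> upper p \<and> lower q"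
  shows "solution_between p q"
proof -
  obtain \<epsilon> :: real where \<epsilon>: "\<epsilon> = 1 \<and> lower p \<and> upper q \<or> \<epsilon> = -1 \<and> upper p \<and> lower q"
    using \<epsilon> by metis
  \<comment> \<open>The translate of \<open>z\<close> with minimum \<open>z 0\<close> in
    \<open>[p, q]\<close> has oscillation at most \<open>C\<close>, so its values lie in
    \<open>[p, q + C]\<close>.\<close>
  have "p \<le> q + C" using pq C_nonneg by simp
  then obtain L where L: "L \<ge> 0"
    "\<And>u s t. cper T u \<Longrightarrow> (\<And>t. p \<le> u t \<and> u t \<le> q + C) \<Longrightarrow> \<bar>V u s - V u t\<bar> \<le> L * \<bar>s - t\<bar>"
    by (rule V_lipschitz) blast
  let ?S = "lip_periodic T L C p q"
  let ?u = "\<lambda>z t. z t + (z 0 - min_value z) :: real"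
  have zper: "cper T z" if "z \<in> ?S" for z
    using lip_periodic_bcontfun[OF that L(1)] that by (auto simp: cper_def bcontfun_def lip_periodic_def)
  have uper: "cper T (?u z)" if "z \<in> ?S" for z
    using zper[OF that] by (auto simp: cper_def intro: continuous_intros)
  have "\<exists>z\<in>?S. reflected_step \<epsilon> p q z = z"
  proof (rule lip_periodic_fixpoint[OF T L(1) C_nonneg less_imp_le[OF pq]])
    fix z assume z: "z \<in> ?S"
    obtain s where s: "min_value z = z s" "\<And>t. z s \<le> z t" using min_value_attained[OF T zper[OF z]] by blast
    have ub: "p \<le> ?u z t \<and> ?u z t \<le> q + C" for t
    proof -
      have "\<bar>z t - z s\<bar> \<le> C" "p \<le> z 0" "z 0 \<le> q" using z by (auto simp: lip_periodic_def)
      then show ?thesis using s(1) s(2)[of t] by auto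
    qed
    show "reflected_step \<epsilon> p q z \<in> ?S"
      using V_cper[OF uper[OF z]] V_osc[OF uper[OF z]] L(2)[OF uper[OF z] ub] pq
      by (auto simp: reflected_step_def Let_def lip_periodic_def cper_def)
  next
    fix z w d t assume z: "z \<in> ?S" and w: "w \<in> ?S" and d: "\<And>t. \<bar>z t - w t\<bar> \<le> d"
    have "\<bar>min_value z - min_value w\<bar> \<le> d" by (rule min_value_lipschitz[OF T zper[OF z] zper[OF w] d])
    \<comment> \<open>The function, its value at 0 and its minimum each change by at most
      \<open>d\<close>.\<close>
    then have "\<bar>?u z t - ?u w t\<bar> \<le> 3 * d" for t using d[of t] d[of 0] by linarith
    note V = V_perturb[OF uper[OF z] uper[OF w] this]
    have mV: "\<bar>min_value (V (?u z)) - min_value (V (?u w))\<bar> \<le> \<kappa> * (3 * d)"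
      by (rule min_value_lipschitz[OF T V_cper[OF uper[OF z]] V_cper[OF uper[OF w]] V])
    have clamp: "\<bar>max p (min q x) - max p (min q y)\<bar> \<le> \<bar>x - y\<bar>" for x y :: real by linarith
    have combine: "\<bar>(A - A' + x) - (B - B' + y)\<bar> \<le> 2 * D + D'"
      if "\<bar>A - B\<bar> \<le> D" "\<bar>A' - B'\<bar> \<le> D" "\<bar>x - y\<bar> \<le> D'" for A A' B B' x y D D' :: real
      using that by linarith
    have reflect: "\<bar>(x + \<epsilon> * (x' - x)) - (y + \<epsilon> * (y' - y))\<bar> \<le> D + 2 * d"
      if "\<bar>x' - y'\<bar> \<le> D" "\<bar>x - y\<bar> \<le> d" for x y x' y' D :: real
      using that \<epsilon> by auto
    have "\<bar>(z 0 + \<epsilon> * (min_value (V (?u z)) - z 0)) - (w 0 + \<epsilon> * (min_value (V (?u w)) - w 0))\<bar> \<le> \<kappa> * (3 * d) + 2 * d"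
      by (rule reflect[OF mV d])
    \<comment> \<open>The difference \<open>v t - v 0\<close> contributes
      \<open>2 * (\<kappa> * (3 * d))\<close>, and the clamped reflected minimum the rest.\<close>
    from order_trans[OF clamp this]
    have "\<bar>reflected_step \<epsilon> p q z t - reflected_step \<epsilon> p q w t\<bar> \<le> 2 * (\<kappa> * (3 * d)) + (\<kappa> * (3 * d) + 2 * d)"
      unfolding reflected_step_def Let_def by (rule combine[OF V V])
    then show "\<bar>reflected_step \<epsilon> p q z t - reflected_step \<epsilon> p q w t\<bar> \<le> (9 * \<kappa> + 2) * d" by (simp add: algebra_simps)
  qed
  then obtain z where z: "z \<in> ?S" "reflected_step \<epsilon> p q z = z" by blast
  then show ?thesis
    using fixpoint_solution[OF zper[OF z(1)] _ z(2) pq _ _ \<epsilon>] by (auto simp: lip_periodic_def)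
qed

end

section \<open>Sign changes and the number of solutions\<close>

text \<open>The denominator grows like \<open>exp (n * p)\<close>, so the quotient grows like
  \<open>exp ((m - n - 1) * p)\<close> up to a constant factor.\<close>

lemma saturated_exp_at_top:
  fixes m n c :: real
  assumes "n > 0" "m > n + 1"
  shows "filterlim (\<lambda>p. exp (m * p) / (1 + exp (n * (p + c))) / exp p) at_top at_top"
proof -
  define d where "d = m - n - 1"
  have "d > 0" using assms by (simp add: d_def)
  with \<open>n > 0\<close> have "filterlim (\<lambda>p. exp (d * p) * exp (n * p) / (1 + exp (n * (p + c)))) at_top at_top"
    by real_asymp
  moreover have "exp (d * p) * exp (n * p) / (1 + exp (n * (p + c))) = exp (m * p) / (1 + exp (n * (p + c))) / exp p" for p
    by (simp add: d_def algebra_simps exp_add exp_diff)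
  ultimately show ?thesis by simp
qed

lemma saturated_exp_at_bot_sublinear:
  fixes m n c :: real
  assumes "n > 0" "0 < m" "m < 1"
  shows "filterlim (\<lambda>p. exp (m * p) / (1 + exp (n * (p + c))) / exp p) at_top at_bot"
  using assms by real_asymp

text \<open>The denominator tends to 1, leaving \<open>exp (m * a) * exp ((m - 1) * p)\<close>: the
  second factor is 1 for \<open>m = 1\<close> and vanishes in the limit for
  \<open>m > 1\<close>.\<close>

lemma saturated_exp_at_bot:
  fixes m n a c :: real
  assumes n: "n > 0" and m: "m \<ge> 1"
  shows "((\<lambda>p. exp (m * (p + a)) / (1 + exp (n * (p + c))) / exp p) \<longlongrightarrow> (if m = 1 then exp a else 0)) at_bot"
proof (cases "m = 1")
  case True
  have "((\<lambda>p. exp a / (1 + exp (n * (p + c)))) \<longlongrightarrow> exp a) at_bot" using n by real_asymp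
  then show ?thesis using True by (simp add: exp_add)
next
  case False
  then have "m > 1" using m by simp
  with n have "((\<lambda>p. exp (m * (p + a)) / (1 + exp (n * (p + c))) / exp p) \<longlongrightarrow> 0) at_bot" by real_asymp
  then show ?thesis using False by simp
qed

context delay_equation
begin

lemma has_at_least_solutions:
  fixes p :: "nat \<Rightarrow> real"
  assumes incr: "\<And>i. i < N \<Longrightarrow> p i < p (Suc i)"
    and alt: "\<And>i. i < N \<Longrightarrow> lower (p i) \<and> upper (p (Suc i)) \<or> upper (p i) \<and> lower (p (Suc i))"
  shows "has_at_least N (positive_periodic_solutions T M lam m n r \<tau> \<mu> b)"
proof -
  have "\<forall>i. \<exists>x. i < N \<longrightarrow> x \<in> positive_periodic_solutions T M lam m n r \<tau> \<mu> b \<and>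
      (\<forall>t. exp (p i) < x t) \<and> (\<exists>t. x t < exp (p (Suc i)))"
    using solution_between_lower_upper[OF incr alt] unfolding solution_between_def by blast
  then obtain x where x: "\<And>i. i < N \<Longrightarrow> x i \<in> positive_periodic_solutions T M lam m n r \<tau> \<mu> b \<and>
      (\<forall>t. exp (p i) < x i t) \<and> (\<exists>t. x i t < exp (p (Suc i)))"
    by metis
  \<comment> \<open>The solution \<open>x i\<close> drops below
    \<open>exp (p (Suc i)) \<le> exp (p j)\<close> somewhere, while \<open>x j\<close> stays above
    \<open>exp (p j)\<close>.\<close>
  have "x i \<noteq> x j" if ij: "i < j" "j < N" for i j
  proof
    assume "x i = x j"
    moreover obtain t where "x i t < exp (p (Suc i))" using x[OF less_trans[OF ij]] by blast
    moreover have "p (Suc i) \<le> p j"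
    proof (rule dec_induct[of "Suc i" j "\<lambda>j. p (Suc i) \<le> p j"])
      show "p (Suc i) \<le> p (Suc k)" if "k < j" "p (Suc i) \<le> p k" for k
        using that incr[of k] \<open>j < N\<close> by simp
    qed (use that in auto)
    moreover have "exp (p j) < x j t" using x that by blast
    ultimately show False by (smt (verit) exp_le_cancel_iff)
  qed
  then have "inj_on x {..<N}" by (intro inj_onI) (metis lessThan_iff nat_neq_iff)
  then show ?thesis
    unfolding has_at_least_def using x by (intro exI[of _ "x ` {..<N}"]) (auto simp: card_image)
qed

section \<open>Limits of weighted sums, uniformly in time\<close>

lemma weighted_sum_uniform:
  assumes "\<And>k. k \<in> {1..M} \<Longrightarrow> ((w k) \<longlongrightarrow> W k) F" "e > 0"
  shows "\<forall>\<^sub>F p in F. \<forall>t. \<bar>(\<Sum>k=1..M. lam k * r k t * w k p) - (\<Sum>k=1..M. lam k * r k t * W k)\<bar> < e"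
proof -
  \<comment> \<open>Bounds on \<open>r k\<close> that hold for all \<open>t\<close> make the
    estimate uniform in time.\<close>
  have "\<forall>k. \<exists>h. k \<in> {1..M} \<longrightarrow> (\<forall>t. r k t \<le> h)" using cper_bounds[OF T r(1)] by metis
  then obtain h where h: "\<And>k t. k \<in> {1..M} \<Longrightarrow> r k t \<le> h k" by metis
  have "((\<lambda>p. \<Sum>k=1..M. lam k * h k * \<bar>w k p - W k\<bar>) \<longlongrightarrow> (\<Sum>k=1..M. lam k * h k * \<bar>W k - W k\<bar>)) F"
    by (intro tendsto_intros assms)
  then have "\<forall>\<^sub>F p in F. (\<Sum>k=1..M. lam k * h k * \<bar>w k p - W k\<bar>) < e"
    using assms(2) by (intro order_tendstoD(2)[where y = "\<Sum>k=1..M. lam k * h k * \<bar>W k - W k\<bar>"]) auto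
  then show ?thesis
  proof eventually_elim
    case (elim p)
    show ?case
    proof
      fix t
      have "\<bar>(\<Sum>k=1..M. lam k * r k t * w k p) - (\<Sum>k=1..M. lam k * r k t * W k)\<bar>
          = \<bar>\<Sum>k=1..M. lam k * r k t * (w k p - W k)\<bar>"
        by (simp add: right_diff_distrib sum_subtractf)
      also have "\<dots> \<le> (\<Sum>k=1..M. \<bar>lam k * r k t * (w k p - W k)\<bar>)" by (rule sum_abs)
      also have "\<dots> \<le> (\<Sum>k=1..M. lam k * h k * \<bar>w k p - W k\<bar>)"
      proof (rule sum_mono)
        fix k assume k: "k \<in> {1..M}"
        have "\<bar>lam k * r k t * (w k p - W k)\<bar> = lam k * r k t * \<bar>w k p - W k\<bar>"
          using abs_of_pos[OF weight_pos[OF k, of t]] by (simp only: abs_mult)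
        also have "\<dots> \<le> lam k * h k * \<bar>w k p - W k\<bar>"
          using pos(1)[OF k] h[OF k] by (intro mult_right_mono mult_left_mono) auto
        finally show "\<bar>lam k * r k t * (w k p - W k)\<bar> \<le> lam k * h k * \<bar>w k p - W k\<bar>" .
      qed
      finally show "\<bar>(\<Sum>k=1..M. lam k * r k t * w k p) - (\<Sum>k=1..M. lam k * r k t * W k)\<bar> < e"
        using elim by simp
    qed
  qed
qed

lemma weighted_sum_cper: "cper T (\<lambda>t. \<Sum>k=1..M. lam k * r k t * W k)"
  using r(1) unfolding cper_def by (auto intro!: continuous_intros sum.cong)

text \<open>The gap between the two sides is continuous and periodic, so it attains a positive
  minimum, which serves as the tolerance in \<open>weighted_sum_uniform\<close>.\<close>

lemma eventually_weighted_sum_gt: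
  assumes w: "\<And>k. k \<in> {1..M} \<Longrightarrow> ((w k) \<longlongrightarrow> W k) F"
    and W: "\<And>t. b t < (\<Sum>k=1..M. lam k * r k t * W k)"
  shows "\<forall>\<^sub>F p in F. \<forall>t. b t < (\<Sum>k=1..M. lam k * r k t * w k p)"
proof -
  have "cper T (\<lambda>t. (\<Sum>k=1..M. lam k * r k t * W k) - b t)"
    using weighted_sum_cper[of W] b(1) by (auto simp: cper_def intro: continuous_intros)
  then obtain s where s: "\<And>t. (\<Sum>k=1..M. lam k * r k s * W k) - b s \<le> (\<Sum>k=1..M. lam k * r k t * W k) - b t"
    using cper_attains_inf[OF T] by blast
  have "\<forall>\<^sub>F p in F. \<forall>t. \<bar>(\<Sum>k=1..M. lam k * r k t * w k p) - (\<Sum>k=1..M. lam k * r k t * W k)\<bar>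
      < (\<Sum>k=1..M. lam k * r k s * W k) - b s"
    by (rule weighted_sum_uniform[OF w]) (use W[of s] in simp_all)
  then show ?thesis
  proof eventually_elim
    case (elim p)
    show ?case
    proof
      fix t show "b t < (\<Sum>k=1..M. lam k * r k t * w k p)" using elim[rule_format, of t] s[of t] by linarith
    qed
  qed
qed

lemma eventually_weighted_sum_lt:
  assumes w: "\<And>k. k \<in> {1..M} \<Longrightarrow> ((w k) \<longlongrightarrow> W k) F"
    and W: "\<And>t. (\<Sum>k=1..M. lam k * r k t * W k) < b t"
  shows "\<forall>\<^sub>F p in F. \<forall>t. (\<Sum>k=1..M. lam k * r k t * w k p) < b t"
proof -
  have "cper T (\<lambda>t. b t - (\<Sum>k=1..M. lam k * r k t * W k))"
    using weighted_sum_cper[of W] b(1) by (auto simp: cper_def intro: continuous_intros)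
  then obtain s where s: "\<And>t. b s - (\<Sum>k=1..M. lam k * r k s * W k) \<le> b t - (\<Sum>k=1..M. lam k * r k t * W k)"
    using cper_attains_inf[OF T] by blast
  have "\<forall>\<^sub>F p in F. \<forall>t. \<bar>(\<Sum>k=1..M. lam k * r k t * w k p) - (\<Sum>k=1..M. lam k * r k t * W k)\<bar>
      < b s - (\<Sum>k=1..M. lam k * r k s * W k)"
    by (rule weighted_sum_uniform[OF w]) (use W[of s] in simp_all)
  then show ?thesis
  proof eventually_elim
    case (elim p)
    show ?case
    proof
      fix t show "(\<Sum>k=1..M. lam k * r k t * w k p) < b t" using elim[rule_format, of t] s[of t] by linarith
    qed
  qed
qed

section \<open>Signs near -infinity and +infinity\<close>

lemma lower_iff: "lower p \<longleftrightarrow> (\<forall>t. b t < (\<Sum>k=1..M. lam k * r k t * (sat k p (p + C) / exp p)))"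
  by (simp add: lower_def pos_less_divide_eq flip: sum_divide_distrib)

lemma upper_iff: "upper p \<longleftrightarrow> (\<forall>t. (\<Sum>k=1..M. lam k * r k t * (sat k (p + C) p / exp p)) < b t)"
  by (simp add: upper_def pos_divide_less_eq flip: sum_divide_distrib)

text \<open>One unbounded term suffices, as all others are positive: its coefficient is bounded
  below by a positive minimum, and \<open>b\<close> is bounded above.\<close>

lemma eventually_lower_of_unbounded:
  assumes j: "j \<in> {1..M}" and lim: "filterlim (\<lambda>p. sat j p (p + C) / exp p) at_top F"
  shows "\<forall>\<^sub>F p in F. lower p"
proof -
  obtain s where s: "\<And>t. r j s \<le> r j t" using cper_attains_inf[OF T r(1)[OF j]] by blast
  obtain h where h: "\<And>t. b t \<le> h" using cper_bounds[OF T b(1)] by metis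
  have "\<forall>\<^sub>F p in F. h / (lam j * r j s) < sat j p (p + C) / exp p"
    using lim by (auto simp: filterlim_at_top_dense)
  then show ?thesis
  proof eventually_elim
    case (elim p)
    show ?case
      unfolding lower_iff
    proof
      fix t
      have "h < lam j * r j s * (sat j p (p + C) / exp p)"
        using elim weight_pos[OF j, of s] by (simp add: pos_divide_less_eq mult.commute)
      also have "\<dots> \<le> lam j * r j t * (sat j p (p + C) / exp p)"
        using s pos(1)[OF j] sat_pos[of j] by (intro mult_right_mono mult_left_mono) (auto intro: less_imp_le)
      also have "\<dots> \<le> (\<Sum>k=1..M. lam k * r k t * (sat k p (p + C) / exp p))"
        using j by (intro member_le_sum[of j] less_imp_le[OF mult_pos_pos[OF weight_pos divide_pos_pos[OF sat_pos]]]) auto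
      finally show "b t < (\<Sum>k=1..M. lam k * r k t * (sat k p (p + C) / exp p))"
        using h[of t] by simp
    qed
  qed
qed

lemma eventually_lower_at_top:
  assumes j: "j \<in> {1..M}" and "m j > n j + 1"
  shows "\<forall>\<^sub>F p in at_top. lower p"
proof (rule eventually_lower_of_unbounded[OF j])
  show "filterlim (\<lambda>p. sat j p (p + C) / exp p) at_top at_top"
    unfolding sat_def by (rule saturated_exp_at_top[OF pos(3)[OF j] assms(2)])
qed

lemma eventually_lower_at_bot_sublinear:
  assumes i: "i \<in> {1..M}" and "m i < 1"
  shows "\<forall>\<^sub>F p in at_bot. lower p"
proof (rule eventually_lower_of_unbounded[OF i])
  show "filterlim (\<lambda>p. sat i p (p + C) / exp p) at_top at_bot"
    unfolding sat_def by (rule saturated_exp_at_bot_sublinear[OF pos(3,2)[OF i] assms(2)])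
qed

lemma sum_M2: "(\<Sum>k=1..M. lam k * r k t * (if m k = 1 then c else 0)) = (\<Sum>k\<in>M2 M m. lam k * r k t * c)"
  unfolding M2_def by (subst sum.inter_filter) (auto intro: sum.cong)

text \<open>The quotients \<open>sat k p (p + C) / exp p\<close> tend to 1 if \<open>m k = 1\<close>
  and to 0 otherwise, so the second hypothesis is the strict inequality for the limits.\<close>

lemma eventually_lower_at_bot_linear:
  assumes m: "\<And>k. k \<in> {1..M} \<Longrightarrow> m k \<ge> 1" and "\<And>t. b t < (\<Sum>k\<in>M2 M m. lam k * r k t)"
  shows "\<forall>\<^sub>F p in at_bot. lower p"
  unfolding lower_iff
proof (rule eventually_weighted_sum_gt)
  show "b t < (\<Sum>k=1..M. lam k * r k t * (if m k = 1 then 1 else 0))" for t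
    using assms(2) by (simp only: sum_M2 mult_1_right)
  show "((\<lambda>p. sat k p (p + C) / exp p) \<longlongrightarrow> (if m k = 1 then 1 else 0)) at_bot"
    if "k \<in> {1..M}" for k
    using saturated_exp_at_bot[OF pos(3) m, OF that that, of 0 C]
    by (simp only: sat_def exp_zero add_0_right)
qed

text \<open>The factor \<open>exp C\<close> is the limit of \<open>sat k (p + C) p / exp p\<close>
  when \<open>m k = 1\<close>: the upper estimate takes the numerator at
  \<open>p + C\<close>.\<close>

lemma eventually_upper_at_bot:
  assumes m: "\<And>k. k \<in> {1..M} \<Longrightarrow> m k \<ge> 1" and "\<And>t. (\<Sum>k\<in>M2 M m. lam k * r k t * exp C) < b t"
  shows "\<forall>\<^sub>F p in at_bot. upper p"
  unfolding upper_iff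
proof (rule eventually_weighted_sum_lt)
  show "(\<Sum>k=1..M. lam k * r k t * (if m k = 1 then exp C else 0)) < b t" for t
    using assms(2) by (simp only: sum_M2)
  show "((\<lambda>p. sat k (p + C) p / exp p) \<longlongrightarrow> (if m k = 1 then exp C else 0)) at_bot"
    if "k \<in> {1..M}" for k
    using saturated_exp_at_bot[OF pos(3) m, OF that that, of C 0]
    by (simp only: sat_def add_0_right)
qed

section \<open>The conditions on \<alpha> and \<beta>\<close>

lemma C_const_eq: "C_const T b = C"
  by (simp add: C_const_def C_def)

text \<open>Apart from the factors \<open>exp (- C * m k) \<le> 1\<close>, the sum in
  \<open>alpha\<close> is that of \<open>lower\<close> divided by \<open>exp p\<close>, so
  positivity of \<open>alpha\<close> is the stronger condition.\<close>

lemma lower_if_alpha_pos: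
  assumes "\<And>t. alpha T M lam m n r b p t > 0"
  shows "lower p"
  unfolding lower_iff
proof
  fix t
  have "b t < (\<Sum>k=1..M. lam k * r k t * (exp ((m k - 1) * p) * exp (- C * m k)) / (1 + exp (n k * (p + C))))"
    using assms[of t] by (simp add: alpha_def C_const_eq)
  also have "\<dots> \<le> (\<Sum>k=1..M. lam k * r k t * (sat k p (p + C) / exp p))"
  proof (rule sum_mono)
    fix k assume k: "k \<in> {1..M}"
    have "exp (- C * m k) \<le> 1" using C_nonneg pos(2)[OF k] by simp
    then have "exp ((m k - 1) * p) * exp (- C * m k) \<le> exp ((m k - 1) * p)" by (simp add: mult_le_cancel_left1)
    then have "lam k * r k t * ((exp ((m k - 1) * p) * exp (- C * m k)) / (1 + exp (n k * (p + C))))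
      \<le> lam k * r k t * (exp ((m k - 1) * p) / (1 + exp (n k * (p + C))))"
      using weight_pos[OF k, of t] by (intro mult_left_mono divide_right_mono) (auto intro: add_nonneg_nonneg)
    moreover have "exp ((m k - 1) * p) = exp (m k * p) / exp p" by (simp add: left_diff_distrib exp_diff)
    ultimately show "lam k * r k t * (exp ((m k - 1) * p) * exp (- C * m k)) / (1 + exp (n k * (p + C)))
      \<le> lam k * r k t * (sat k p (p + C) / exp p)"
      by (simp add: sat_def mult.commute)
  qed
  finally show "b t < (\<Sum>k=1..M. lam k * r k t * (sat k p (p + C) / exp p))" .
qed

text \<open>The numerators agree after division by \<open>exp p\<close>, while \<open>beta\<close>
  has \<open>p - C\<close> instead of \<open>p\<close> in the denominator. This makes its terms at
  least as large, so negativity of \<open>beta\<close> is the stronger condition.\<close>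

lemma upper_if_beta_neg:
  assumes "\<And>t. beta T M lam m n r b p t < 0"
  shows "upper p"
  unfolding upper_iff
proof
  fix t
  have "(\<Sum>k=1..M. lam k * r k t * (sat k (p + C) p / exp p))
    \<le> (\<Sum>k=1..M. lam k * r k t * (exp ((m k - 1) * p) * exp (C * m k)) / (1 + exp (n k * (p - C))))"
  proof (rule sum_mono)
    fix k assume k: "k \<in> {1..M}"
    have "n k * (p - C) \<le> n k * p" using C_nonneg pos(3)[OF k] by simp
    then have "exp ((m k - 1) * p) * exp (C * m k) / (1 + exp (n k * p))
      \<le> exp ((m k - 1) * p) * exp (C * m k) / (1 + exp (n k * (p - C)))"
      by (intro divide_left_mono mult_pos_pos add_pos_pos) auto
    then have "lam k * r k t * (exp ((m k - 1) * p) * exp (C * m k) / (1 + exp (n k * p)))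
      \<le> lam k * r k t * (exp ((m k - 1) * p) * exp (C * m k) / (1 + exp (n k * (p - C))))"
      using weight_pos[OF k, of t] by (intro mult_left_mono) auto
    moreover have "exp ((m k - 1) * p) * exp (C * m k) = exp (m k * (p + C)) / exp p"
      by (simp add: algebra_simps flip: exp_add exp_diff)
    ultimately show "lam k * r k t * (sat k (p + C) p / exp p)
      \<le> lam k * r k t * (exp ((m k - 1) * p) * exp (C * m k)) / (1 + exp (n k * (p - C)))"
      by (simp add: sat_def mult.commute)
  qed
  also have "\<dots> < b t" using assms[of t] by (simp add: beta_def C_const_eq)
  finally show "(\<Sum>k=1..M. lam k * r k t * (sat k (p + C) p / exp p)) < b t" .
qed

end

section \<open>Choice of the levels and the five cases\<close>

lemma eventually_at_bot_less:
  fixes c :: real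
  assumes "\<forall>\<^sub>F p in at_bot. P p"
  obtains p where "p < c" "P p"
  using eventually_happens[OF eventually_conj[OF assms eventually_gt_at_bot[of c]]] by (auto simp: trivial_limit_at_bot_linorder)

lemma eventually_at_top_greater:
  fixes c :: real
  assumes "\<forall>\<^sub>F p in at_top. P p"
  obtains p where "c < p" "P p"
  using eventually_happens[OF eventually_conj[OF assms eventually_gt_at_top[of c]]] by auto

theorem theorem3p1:
  fixes T :: real and M :: nat
    and lam m n :: "nat \<Rightarrow> real"
    and r \<tau> \<mu> :: "nat \<Rightarrow> real \<Rightarrow> real"
    and b :: "real \<Rightarrow> real"
  assumes T: "T > 0" and M: "M \<ge> 1"
    and pos: "\<And>k. k \<in> {1..M} \<Longrightarrow> lam k > 0 \<and> m k > 0 \<and> n k > 0"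
    and r: "\<And>k. k \<in> {1..M} \<Longrightarrow>
      continuous_on UNIV (r k) \<and> (\<forall>t. r k t > 0) \<and> periodic_fun_simple (r k) T"
    and \<tau>: "\<And>k. k \<in> {1..M} \<Longrightarrow>
      continuous_on UNIV (\<tau> k) \<and> (\<forall>t. \<tau> k t > 0) \<and> periodic_fun_simple (\<tau> k) T"
    and \<mu>: "\<And>k. k \<in> {1..M} \<Longrightarrow>
      continuous_on UNIV (\<mu> k) \<and> (\<forall>t. \<mu> k t > 0) \<and> periodic_fun_simple (\<mu> k) T"
    and b: "continuous_on UNIV b \<and> (\<forall>t. b t > 0) \<and> periodic_fun_simple b T"
    and superlinear: "\<exists>j\<in>{1..M}. m j > n j + 1"
  shows
    "((\<forall>k\<in>{1..M}. m k > 1) \<and> (\<exists>i\<in>{1..M}. 1 < m i \<and> m i < n i + 1) \<and>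
      (\<exists>\<gamma>\<^sub>1 \<gamma>\<^sub>2. \<gamma>\<^sub>1 < \<gamma>\<^sub>2 \<and>
        (\<forall>t. alpha T M lam m n r b \<gamma>\<^sub>1 t > 0 \<and> 0 > beta T M lam m n r b \<gamma>\<^sub>2 t))
      \<longrightarrow> has_at_least 3 (positive_periodic_solutions T M lam m n r \<tau> \<mu> b))
   \<and> ((\<forall>k\<in>{1..M}. m k \<ge> 1) \<and> (\<exists>i\<in>{1..M}. m i = 1) \<and>
      (\<forall>k\<in>{1..M}. m k \<notin> {1<..<n k + 1}) \<and>
      (\<forall>t. (\<Sum>k\<in>M2 M m. lam k * r k t) > b t) \<and>
      (\<exists>\<gamma>\<^sub>1. \<forall>t. beta T M lam m n r b \<gamma>\<^sub>1 t < 0)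
      \<longrightarrow> has_at_least 2 (positive_periodic_solutions T M lam m n r \<tau> \<mu> b))
   \<and> ((\<forall>k\<in>{1..M}. m k \<ge> 1) \<and> (\<exists>i\<in>{1..M}. m i = 1) \<and>
      (\<exists>s\<in>{1..M}. 1 < m s \<and> m s < n s + 1) \<and>
      (\<forall>t. (\<Sum>k\<in>M2 M m. lam k * r k t * exp (C_const T b)) < b t) \<and>
      (\<exists>\<gamma>\<^sub>1 \<gamma>\<^sub>2. \<gamma>\<^sub>1 < \<gamma>\<^sub>2 \<and>
        (\<forall>t. alpha T M lam m n r b \<gamma>\<^sub>1 t > 0 \<and> 0 > beta T M lam m n r b \<gamma>\<^sub>2 t))
      \<longrightarrow> has_at_least 3 (positive_periodic_solutions T M lam m n r \<tau> \<mu> b))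
   \<and> ((\<exists>i\<in>{1..M}. m i < 1) \<and> (\<forall>k\<in>{1..M}. m k \<notin> {1<..<n k + 1}) \<and>
      (\<exists>\<gamma>\<^sub>1. \<forall>t. beta T M lam m n r b \<gamma>\<^sub>1 t < 0)
      \<longrightarrow> has_at_least 2 (positive_periodic_solutions T M lam m n r \<tau> \<mu> b))
   \<and> ((\<exists>i\<in>{1..M}. m i < 1) \<and> (\<exists>s\<in>{1..M}. 1 < m s \<and> m s < n s + 1) \<and>
      (\<exists>\<gamma>\<^sub>1 \<gamma>\<^sub>2 \<gamma>\<^sub>3. \<gamma>\<^sub>1 < \<gamma>\<^sub>2 \<and> \<gamma>\<^sub>2 < \<gamma>\<^sub>3 \<and>
        (\<forall>t. alpha T M lam m n r b \<gamma>\<^sub>2 t > 0 \<and>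
             beta T M lam m n r b \<gamma>\<^sub>1 t < 0 \<and> beta T M lam m n r b \<gamma>\<^sub>3 t < 0))
      \<longrightarrow> has_at_least 4 (positive_periodic_solutions T M lam m n r \<tau> \<mu> b))"
proof -
  interpret delay_equation T M lam m n r \<tau> \<mu> b
    using assms by unfold_locales (auto simp: cper_def periodic_fun_simple_def)
  obtain j where "j \<in> {1..M}" "m j > n j + 1" using superlinear by blast
  then have top: "\<forall>\<^sub>F p in at_top. lower p" by (rule eventually_lower_at_top)
  let ?A = "positive_periodic_solutions T M lam m n r \<tau> \<mu> b"
  \<comment> \<open>Levels in the order lower, upper, lower: two sign changes.\<close>
  have two: "has_at_least 2 ?A" if bot: "\<forall>\<^sub>F p in at_bot. lower p" and "upper \<gamma>" for \<gamma>
  proof -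
    obtain p where p: "p < \<gamma>" "lower p" using eventually_at_bot_less[OF bot] by blast
    obtain q where q: "\<gamma> < q" "lower q" using eventually_at_top_greater[OF top] by blast
    show ?thesis
      by (rule has_at_least_solutions[of 2 "\<lambda>i. [p, \<gamma>, q] ! i"])
        (use p q \<open>upper \<gamma>\<close> in \<open>auto simp: less_Suc_eq numeral_eq_Suc\<close>)
  qed
  \<comment> \<open>Levels in the order upper, lower, upper, lower; the last one comes from
    \<open>top\<close>.\<close>
  have three: "has_at_least 3 ?A"
    if bot: "\<forall>\<^sub>F p in at_bot. upper p" and \<gamma>: "\<gamma> < \<gamma>'" "lower \<gamma>" "upper \<gamma>'" for \<gamma> \<gamma>'
  proof -
    obtain p where p: "p < \<gamma>" "upper p" using eventually_at_bot_less[OF bot] by blast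
    obtain q where q: "\<gamma>' < q" "lower q" using eventually_at_top_greater[OF top] by blast
    show ?thesis
      by (rule has_at_least_solutions[of 3 "\<lambda>i. [p, \<gamma>, \<gamma>', q] ! i"])
        (use p q \<gamma> in \<open>auto simp: less_Suc_eq numeral_eq_Suc\<close>)
  qed
  \<comment> \<open>Levels in the order lower, upper, lower, upper, lower.\<close>
  have four: "has_at_least 4 ?A"
    if bot: "\<forall>\<^sub>F p in at_bot. lower p" and \<gamma>: "\<gamma>1 < \<gamma>2" "\<gamma>2 < \<gamma>3" "upper \<gamma>1" "lower \<gamma>2" "upper \<gamma>3" for \<gamma>1 \<gamma>2 \<gamma>3
  proof -
    obtain p where p: "p < \<gamma>1" "lower p" using eventually_at_bot_less[OF bot] by blast
    obtain q where q: "\<gamma>3 < q" "lower q" using eventually_at_top_greater[OF top] by blast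
    show ?thesis
      by (rule has_at_least_solutions[of 4 "\<lambda>i. [p, \<gamma>1, \<gamma>2, \<gamma>3, q] ! i"])
        (use p q \<gamma> in \<open>auto simp: less_Suc_eq numeral_eq_Suc\<close>)
  qed
  show ?thesis
  proof (intro conjI impI; elim conjE exE bexE)
    fix i \<gamma>\<^sub>1 \<gamma>\<^sub>2
    assume m: "\<forall>k\<in>{1..M}. m k > 1" and \<gamma>: "\<gamma>\<^sub>1 < \<gamma>\<^sub>2"
      "\<forall>t. alpha T M lam m n r b \<gamma>\<^sub>1 t > 0 \<and> 0 > beta T M lam m n r b \<gamma>\<^sub>2 t"
    \<comment> \<open>With all exponents above 1 the sum over \<open>M2 M m\<close> is empty, hence
      below \<open>b\<close>, and \<open>eventually_upper_at_bot\<close> applies.\<close>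
    have "k \<notin> M2 M m" for k using bspec[OF m, of k] by (auto simp: M2_def)
    then have "M2 M m = {}" by blast
    then have "\<forall>\<^sub>F p in at_bot. upper p"
      using m b by (intro eventually_upper_at_bot) (auto intro: less_imp_le)
    then show "has_at_least 3 ?A"
      by (rule three[OF _ \<gamma>(1) lower_if_alpha_pos upper_if_beta_neg]) (use \<gamma>(2) in auto)
  next
    fix i \<gamma>\<^sub>1
    assume "\<forall>k\<in>{1..M}. m k \<ge> 1" "\<forall>t. (\<Sum>k\<in>M2 M m. lam k * r k t) > b t"
      and \<gamma>: "\<forall>t. beta T M lam m n r b \<gamma>\<^sub>1 t < 0"
    then have "\<forall>\<^sub>F p in at_bot. lower p" by (intro eventually_lower_at_bot_linear) auto
    then show "has_at_least 2 ?A"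
      by (rule two[OF _ upper_if_beta_neg]) (use \<gamma> in auto)
  next
    fix i s \<gamma>\<^sub>1 \<gamma>\<^sub>2
    assume "\<forall>k\<in>{1..M}. m k \<ge> 1" "\<forall>t. (\<Sum>k\<in>M2 M m. lam k * r k t * exp (C_const T b)) < b t"
      and \<gamma>: "\<gamma>\<^sub>1 < \<gamma>\<^sub>2" "\<forall>t. alpha T M lam m n r b \<gamma>\<^sub>1 t > 0 \<and> 0 > beta T M lam m n r b \<gamma>\<^sub>2 t"
    then have "\<forall>\<^sub>F p in at_bot. upper p" by (intro eventually_upper_at_bot) (auto simp: C_const_eq)
    then show "has_at_least 3 ?A"
      by (rule three[OF _ \<gamma>(1) lower_if_alpha_pos upper_if_beta_neg]) (use \<gamma>(2) in auto)
  next
    fix i \<gamma>\<^sub>1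
    assume "i \<in> {1..M}" "m i < 1" and \<gamma>: "\<forall>t. beta T M lam m n r b \<gamma>\<^sub>1 t < 0"
    from eventually_lower_at_bot_sublinear[OF this(1,2)] show "has_at_least 2 ?A"
      by (rule two[OF _ upper_if_beta_neg]) (use \<gamma> in auto)
  next
    fix i s \<gamma>\<^sub>1 \<gamma>\<^sub>2 \<gamma>\<^sub>3
    assume "i \<in> {1..M}" "m i < 1" and \<gamma>: "\<gamma>\<^sub>1 < \<gamma>\<^sub>2" "\<gamma>\<^sub>2 < \<gamma>\<^sub>3"
      "\<forall>t. alpha T M lam m n r b \<gamma>\<^sub>2 t > 0 \<and>
             beta T M lam m n r b \<gamma>\<^sub>1 t < 0 \<and> beta T M lam m n r b \<gamma>\<^sub>3 t < 0"
    from eventually_lower_at_bot_sublinear[OF this(1,2)] show "has_at_least 4 ?A"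
      by (rule four[OF _ \<gamma>(1,2) upper_if_beta_neg lower_if_alpha_pos upper_if_beta_neg]) (use \<gamma>(3) in auto)
  qed
qed

end
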